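(* Let $\alpha\in\mathbb{R}$ and $\theta\in(-\infty,1]$. Let the convolution weights $\{\omega_j\}_{j\ge0}$ be $$\omega_j=\Big(\frac{2}{3-2\theta}\Big)^{\alpha}\big[(1-\alpha\theta)\kappa_j+\alpha\theta\,\kappa_{j-1}\big],\qquad \kappa_j=(-1)^j\sum_{k=0}^{j}\Big(\frac{1-2\theta}{3-2\theta}\Big)^{j-k}\binom{-\alpha}{k}\binom{-\alpha}{j-k},$$ with $\kappa_{-1}=0$. Then the fractional convolution quadrature with weights $\omega_j$ is convergent (to $I^{\alpha}$) of order $2$.
   Context: Generalized binomial coefficients: $\binom{a}{k}=a(a-1)\cdots(a-k+1)/k!$, $\binom{a}{0}=1$; $0^0=1$. The weights are the power series coefficients of $\omega(\xi)=\frac{1-\alpha\theta+\alpha\theta\xi}{[(3/2-\theta)-(2-2\theta)\xi+(1/2-\theta)\xi^2]^{\alpha}}$ at $\xi=0$ (the "fractional BN-$\theta$ method"). Fractional operators: for $\alpha>0$, $I^{\alpha}u(x)=\frac1{\Gamma(\alpha)}\int_0^x(x-s)^{\alpha-1}u(s)\,ds$; $I^0$ is the identity; for $\alpha>0$ and $n=\lceil\alpha\rceil$, $I^{-\alpha}u=\frac{d^n}{dx^n}I^{n-\alpha}u$. On powers, for $\beta\in\mathbb{C}\setminus\{-1,-2,\dots\}$ and every real $\alpha$, $(I^{\alpha}x^{\beta})(x)=\frac{\Gamma(\beta+1)}{\Gamma(\alpha+\beta+1)}x^{\alpha+\beta}$ for $x>0$ (by analytic continuation in $\beta$ where the integral diverges,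 with $1/\Gamma=0$ at the nonpositive integers). Grid: $x_n=nh$, $h>0$, $0\le x_n\le L$. Convergence of order 2: a convolution quadrature with weights $\{\omega_j\}$ is convergent (to $I^\alpha$) of order $2$ if for all $\beta\in\mathbb{C}\setminus\{-1,-2,\dots\}$, $$(I^{\alpha}x^{\beta})(x_n)-h^{\alpha}\sum_{j=0}^{n}\omega_{n-j}x_j^{\beta}=O(x_n^{\alpha+\beta-2}h^2)+O(x_n^{\alpha-1}h^{\beta+1}),$$ meaning that there is a constant $C$ (independent of $n\ge1$ and $h$) such that the absolute value of the left side is at most $C\big(x_n^{\alpha+\mathrm{Re}\beta-2}h^2+x_n^{\alpha-1}h^{\mathrm{Re}\beta+1}\big)$ for all $n\ge1$, $h>0$ with $x_n\le L$. In the sum, the term $x_0^\beta=0^\beta$ is $0$ when $\beta\ne0$ and $1$ when $\beta=0$. *)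

theory Defs
  imports "HOL-Complex_Analysis.Complex_Analysis"
begin

(* Here of_real 0 powr b = 0 for every complex b, including b = 0, so the convention 0^0 = 1
   has to be imposed separately. *)
definition power_fun :: "complex \<Rightarrow> real \<Rightarrow> complex" where
  "power_fun \<beta> x = (if \<beta> = 0 then 1 else of_real x powr \<beta>)"

(* Intended for a >= 0 only. *)
definition frac_integral :: "real \<Rightarrow> (real \<Rightarrow> complex) \<Rightarrow> real \<Rightarrow> complex" where
  "frac_integral a u x =
     (if a = 0 then u x
      else (1 / Gamma a) *\<^sub>R integral {0..x} (\<lambda>s. ((x - s) powr (a - 1)) *\<^sub>R u s))"

(* For a < 0 the order of differentiation is n = ceiling (-a), applied to I^(n - (-a)) u. *)
definition frac_op :: "real \<Rightarrow> (real \<Rightarrow> complex) \<Rightarrow> real \<Rightarrow> complex" where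
  "frac_op a u =
     (if a \<ge> 0 then frac_integral a u
      else ((\<lambda>f x. vector_derivative f (at x)) ^^ nat \<lceil>-a\<rceil>)
             (frac_integral (of_int \<lceil>-a\<rceil> + a) u))"

definition admissible_exponents :: "complex set" where
  "admissible_exponents = - {\<beta>. \<exists>m::nat. m \<ge> 1 \<and> \<beta> = - of_nat m}"

(* (I^a x^b)(x) for x > 0.  If Re b > -1, the integral in the operator converges and this is the
   operator applied to the power function; for the other admissible b it is the analytic
   continuation in b.  The admissible exponents form a connected open set, so the function
   chosen by SOME is determined on that set; there it equals
   Gamma (b + 1) * rGamma (a + b + 1) * x powr (a + b). *)
definition frac_op_power :: "real \<Rightarrow> complex \<Rightarrow> real \<Rightarrow> complex" where
  "frac_op_power a \<beta> x =
     (SOME F. F holomorphic_on admissible_exponents \<and>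
        (\<forall>b. Re b > -1 \<longrightarrow> F b = frac_op a (power_fun b) x)) \<beta>"

(* The grid is x_j = j * h, restricted to [0, L]. *)
definition conv_quad_convergent_order2 ::
    "real \<Rightarrow> real \<Rightarrow> (nat \<Rightarrow> real) \<Rightarrow> bool" where
  "conv_quad_convergent_order2 L \<alpha> \<omega> \<longleftrightarrow>
     (\<forall>\<beta>\<in>admissible_exponents. \<exists>C::real. \<forall>n::nat. \<forall>h::real.
        n \<ge> 1 \<and> h > 0 \<and> real n * h \<le> L \<longrightarrow>
        norm (frac_op_power \<alpha> \<beta> (real n * h)
              - of_real (h powr \<alpha>) *
                  (\<Sum>j\<le>n. of_real (\<omega> (n - j)) * power_fun \<beta> (real j * h)))
        \<le> C * ((real n * h) powr (\<alpha> + Re \<beta> - 2) * h ^ 2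
               + (real n * h) powr (\<alpha> - 1) * h powr (Re \<beta> + 1)))"

definition bn_kappa :: "real \<Rightarrow> real \<Rightarrow> nat \<Rightarrow> real" where
  "bn_kappa \<alpha> \<theta> j =
     (-1) ^ j * (\<Sum>k\<le>j. ((1 - 2 * \<theta>) / (3 - 2 * \<theta>)) ^ (j - k) *
                          ((-\<alpha>) gchoose k) * ((-\<alpha>) gchoose (j - k)))"

definition bn_weight :: "real \<Rightarrow> real \<Rightarrow> nat \<Rightarrow> real" where
  "bn_weight \<alpha> \<theta> j =
     (2 / (3 - 2 * \<theta>)) powr \<alpha> *
       ((1 - \<alpha> * \<theta>) * bn_kappa \<alpha> \<theta> j
        + \<alpha> * \<theta> * (if j = 0 then 0 else bn_kappa \<alpha> \<theta> (j - 1)))"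

end

theory Submission
  imports Defs
begin

text \<open>
  Up to the factor \<open>h powr (\<alpha> + \<beta>)\<close> the error depends on \<open>n\<close> only, so the claim is an asymptotic
  statement about the coefficients of a product of power series. The sequence \<open>n powr \<beta>\<close> nearly
  satisfies the first-order recurrence of the coefficients of \<open>(1 - X) powr (-\<beta> - 1)\<close>; hence it
  expands to any order in the coefficients of \<open>(1 - X) powr (-\<gamma>)\<close>,
  \<open>\<gamma> = \<beta> + 1, \<beta>, \<dots>\<close>, and the remainder is so small that its convolution with the weights is
  \<open>O(n powr (\<alpha> - 1))\<close>. For each basis element the quadrature is a coefficient of
  \<open>(1 - X) powr (-\<delta>) * (1 - r X) powr (-\<alpha>)\<close> with \<open>|r| \<le> 1\<close>, \<open>r \<noteq> 1\<close>. The identity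
  \<open>1 - r = (1 - r X) - r (1 - X)\<close> lowers one of the two exponents at a time, which reduces all
  estimates to absolutely summable factors; this treats \<open>|r| < 1\<close> and the boundary case \<open>r = -1\<close>
  (that is \<open>\<theta> = 1\<close>) alike. The terms of order \<open>n powr (\<alpha> + \<beta> - 1)\<close> cancel because
  \<open>\<alpha> r / (1 - r) + \<alpha> \<theta> = \<alpha> / 2\<close>.
\<close>

section \<open>Sequences dominated by powers\<close>

text \<open>Exponents of any real part occur, so neither the weights nor the values
  \<open>n powr \<beta>\<close> need be absolutely summable, while a convolution can be estimated
  termwise only if one factor is. All reductions aim at that situation. They also explain the shape
  of the error: a convolution of sequences of sizes \<open>n powr (a - 1)\<close> and
  \<open>n powr (b - 1)\<close>, one of them summable, is bounded by the sum of both sizes, and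
  these two sizes become the two terms in the definition of order 2. Only the first two coefficients
  of the expansion of \<open>n powr \<beta>\<close> are computed. Further terms are needed solely to
  push the remainder below \<open>n powr (-2)\<close> and below
  \<open>n powr (\<alpha> - 1)\<close>, so their number depends on \<alpha> and \<beta>. The
  recurrence relates \<open>n powr \<beta>\<close> to lower powers. If \<beta> is a nonnegative
  integer these include \<open>n powr (-1)\<close>, which has no such expansion, since its basis
  sequences vanish eventually. Integers are therefore treated by multiplication with
  \<open>n\<close> instead.\<close>

definition weight :: "real \<Rightarrow> nat \<Rightarrow> real" where
  "weight s n = real (Suc n) powr s"

text \<open>A Landau bound with one constant from index 0 on, since convolutions use all indices. As
  \<open>weight\<close> is taken at \<open>Suc n\<close> it never vanishes, so an eventual bound
  suffices (\<open>dominated_by_eventuallyI\<close>).\<close>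

definition dominated_by :: "(nat \<Rightarrow> 'a::real_normed_vector) \<Rightarrow> (nat \<Rightarrow> real) \<Rightarrow> bool" where
  "dominated_by f g \<longleftrightarrow> (\<exists>C. \<forall>n. norm (f n) \<le> C * g n)"

lemma weight_pos [simp]: "weight s n > 0"
  by (simp add: weight_def)

lemma weight_nonneg [simp]: "weight s n \<ge> 0"
  by (simp add: weight_def)

lemma weight_mono: "s \<le> t \<Longrightarrow> weight s n \<le> weight t n"
  by (simp add: weight_def powr_mono)

lemma weight_add: "weight (s + t) n = weight s n * weight t n"
  by (simp add: weight_def powr_add)

lemma weight_0 [simp]: "weight 0 n = 1"
  by (simp add: weight_def)

lemma weight_antimono: "s \<le> 0 \<Longrightarrow> m \<le> n \<Longrightarrow> weight s n \<le> weight s m"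
  by (simp add: weight_def powr_mono2')

lemma weight_mono_index: "s \<ge> 0 \<Longrightarrow> m \<le> n \<Longrightarrow> weight s m \<le> weight s n"
  by (simp add: weight_def powr_mono2)

text \<open>Indices within a factor 2 of each other have comparable weights, whatever the sign of
  \<open>s\<close>. This permits cutting a convolution in the middle and shifting an index by
  one.\<close>

lemma weight_half_le:
  assumes "m \<le> n" "n \<le> 2 * m"
  shows "weight s m \<le> 2 powr \<bar>s\<bar> * weight s n"
proof (cases "s \<ge> 0")
  case True
  have "weight s m \<le> weight s n"
    using True assms by (intro weight_mono_index) auto
  also have "\<dots> \<le> 2 powr \<bar>s\<bar> * weight s n"
    using True ge_one_powr_ge_zero[of 2 "\<bar>s\<bar>"] mult_right_mono[of 1 "2 powr \<bar>s\<bar>" "weight s n"] by simp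
  finally show ?thesis .
next
  case False
  have "real (Suc n) \<le> 2 * real (Suc m)"
    using assms by simp
  then have "(2 * real (Suc m)) powr s \<le> real (Suc n) powr s"
    using False by (intro powr_mono2') auto
  then have "2 powr s * weight s m \<le> weight s n"
    by (subst (asm) powr_mult) (auto simp: weight_def)
  then have "2 powr (-s) * (2 powr s * weight s m) \<le> 2 powr (-s) * weight s n"
    by (intro mult_left_mono) auto
  then show ?thesis
    using False by (simp add: powr_minus field_simps)
qed

lemma summable_weight: "s < -1 \<Longrightarrow> summable (weight s)"
  unfolding weight_def using summable_real_powr_iff[of s]
  by (subst summable_Suc_iff[of "\<lambda>n. real n powr s"]) auto

lemma dominated_byI: "(\<And>n. norm (f n) \<le> C * g n) \<Longrightarrow> dominated_by f g"
  unfolding dominated_by_def by blast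

lemma dominated_byE:
  assumes "dominated_by f g" "\<And>n. g n \<ge> 0"
  obtains C where "C > 0" "\<And>n. norm (f n) \<le> C * g n"
proof -
  obtain C where C: "\<And>n. norm (f n) \<le> C * g n"
    using assms(1) unfolding dominated_by_def by blast
  have "norm (f n) \<le> max C 1 * g n" for n
  proof -
    have "C * g n \<le> max C 1 * g n"
      using assms(2)[of n] by (intro mult_right_mono) auto
    with C[of n] show ?thesis by linarith
  qed
  then show thesis by (intro that[of "max C 1"]) auto
qed

lemma dominated_by_eventuallyI:
  assumes "\<And>n. g n > 0" "\<forall>\<^sub>F n in sequentially. norm (f n) \<le> C * g n"
  shows "dominated_by f g"
proof -
  obtain N where N: "\<And>n. n \<ge> N \<Longrightarrow> norm (f n) \<le> C * g n"
    using assms(2) unfolding eventually_sequentially by blast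
  define D where "D = \<bar>C\<bar> + (\<Sum>i<N. norm (f i) / g i)"
  have "norm (f n) \<le> D * g n" for n
  proof (cases "n < N")
    case True
    then have "norm (f n) / g n \<le> (\<Sum>i<N. norm (f i) / g i)"
      using assms(1) by (intro member_le_sum) (auto simp: less_imp_le)
    then have "norm (f n) / g n \<le> D" unfolding D_def by simp
    then show ?thesis using assms(1)[of n] by (simp add: field_simps)
  next
    case False
    have "(\<Sum>i<N. norm (f i) / g i) \<ge> 0"
      using assms(1) by (intro sum_nonneg) (auto simp: less_imp_le)
    then have "C \<le> D" unfolding D_def by simp
    then have "C * g n \<le> D * g n"
      using assms(1)[of n] by (intro mult_right_mono) auto
    with N[of n] False show ?thesis by linarith
  qed
  then show ?thesis by (rule dominated_byI)
qed

lemma dominated_by_mono: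
  assumes "dominated_by f g" "\<And>n. g n \<ge> 0" "\<And>n. g n \<le> K * g' n" "\<And>n. g' n \<ge> 0"
  shows "dominated_by f g'"
proof -
  obtain C where C: "C > 0" "\<And>n. norm (f n) \<le> C * g n"
    using dominated_byE assms(1,2) by blast
  have "norm (f n) \<le> (C * K) * g' n" for n
  proof -
    have "C * g n \<le> C * (K * g' n)" using C(1) assms(3) by (intro mult_left_mono) auto
    then show ?thesis using C(2)[of n] by (simp add: mult.assoc)
  qed
  then show ?thesis by (rule dominated_byI)
qed

lemma dominated_by_weight_mono:
  "dominated_by f (weight s) \<Longrightarrow> s \<le> t \<Longrightarrow> dominated_by f (weight t)"
  using dominated_by_mono[of f "weight s" 1 "weight t"] by (simp add: weight_mono)

lemma dominated_by_weight2_mono: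
  assumes "dominated_by f (\<lambda>n. weight s n + weight t n)" "s \<le> s'" "t \<le> t'"
  shows "dominated_by f (\<lambda>n. weight s' n + weight t' n)"
  using assms(1) by (rule dominated_by_mono[where K = 1])
    (use assms weight_mono in \<open>auto intro!: add_mono add_nonneg_nonneg\<close>)

lemma dominated_by_weight2I1:
  assumes "dominated_by f (weight s)" "s \<le> s'"
  shows "dominated_by f (\<lambda>n. weight s' n + weight t n)"
  using assms(1) by (rule dominated_by_mono[where K = 1])
    (use assms weight_mono[of s s'] in \<open>auto intro!: add_increasing2 add_nonneg_nonneg\<close>)

lemma dominated_by_weight2I2:
  assumes "dominated_by f (weight t)" "t \<le> t'"
  shows "dominated_by f (\<lambda>n. weight s n + weight t' n)"
  using dominated_by_weight2I1[OF assms, of s] by (simp add: add.commute)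

lemma dominated_by_cong: "dominated_by f g \<Longrightarrow> (\<And>n. f' n = f n) \<Longrightarrow> dominated_by f' g"
  by presburger

lemma dominated_by_zero: "(\<And>n. g n \<ge> 0) \<Longrightarrow> dominated_by (\<lambda>_. 0) g"
  by (rule dominated_byI[where C = 0]) auto

lemma dominated_by_add:
  assumes "dominated_by f g" "dominated_by f' g"
  shows "dominated_by (\<lambda>n. f n + f' n) g"
proof -
  obtain C D where "\<And>n. norm (f n) \<le> C * g n" "\<And>n. norm (f' n) \<le> D * g n"
    using assms unfolding dominated_by_def by blast
  then have "norm (f n + f' n) \<le> (C + D) * g n" for n
    by (simp add: distrib_right) (meson add_mono norm_triangle_le)
  then show ?thesis by (rule dominated_byI)
qed

lemma dominated_by_mult:
  fixes f :: "nat \<Rightarrow> 'a::real_normed_algebra"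
  assumes "dominated_by f g" "dominated_by f' g'" "\<And>n. g n \<ge> 0" "\<And>n. g' n \<ge> 0"
  shows "dominated_by (\<lambda>n. f n * f' n) (\<lambda>n. g n * g' n)"
proof -
  obtain C D where C: "C > 0" "\<And>n. norm (f n) \<le> C * g n" and D: "D > 0" "\<And>n. norm (f' n) \<le> D * g' n"
    using assms dominated_byE by metis
  have "norm (f n * f' n) \<le> (C * D) * (g n * g' n)" for n
  proof -
    have "norm (f n * f' n) \<le> norm (f n) * norm (f' n)" by (rule norm_mult_ineq)
    also have "\<dots> \<le> (C * g n) * (D * g' n)"
      using C D assms by (intro mult_mono) auto
    finally show ?thesis by (simp add: mult_ac)
  qed
  then show ?thesis by (rule dominated_byI)
qed

lemma dominated_by_cmult:
  fixes f :: "nat \<Rightarrow> 'a::real_normed_algebra"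
  assumes "dominated_by f g"
  shows "dominated_by (\<lambda>n. c * f n) g"
proof -
  obtain C where C: "\<And>n. norm (f n) \<le> C * g n"
    using assms unfolding dominated_by_def by blast
  have "norm (c * f n) \<le> (norm c * C) * g n" for n
    using norm_mult_ineq[of c "f n"] mult_left_mono[OF C[of n] norm_ge_zero[of c]]
    by (simp add: mult.assoc)
  then show ?thesis by (rule dominated_byI)
qed

lemma dominated_by_diff:
  fixes f :: "nat \<Rightarrow> 'a::real_normed_algebra_1"
  assumes "dominated_by f g" "dominated_by f' g"
  shows "dominated_by (\<lambda>n. f n - f' n) g"
  using dominated_by_add[OF assms(1) dominated_by_cmult[OF assms(2), of "-1"]] by simp

lemma dominated_by_sum:
  assumes "\<And>i. i \<in> I \<Longrightarrow> dominated_by (f i) g" "\<And>n. g n \<ge> 0"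
  shows "dominated_by (\<lambda>n. \<Sum>i\<in>I. f i n) g"
  using assms
proof (induction I rule: infinite_finite_induct)
  case (insert i I)
  then show ?case using dominated_by_add[of "f i" g "\<lambda>n. \<Sum>i\<in>I. f i n"] by simp
qed (simp_all add: dominated_by_zero)

lemma dominated_by_weight_SucD:
  assumes "dominated_by (\<lambda>n. f (Suc n)) (weight s)"
  shows "dominated_by f (weight s)"
proof -
  obtain C where C: "C > 0" "\<And>n. norm (f (Suc n)) \<le> C * weight s n"
    using dominated_byE[OF assms] by auto
  have "\<forall>\<^sub>F n in sequentially. norm (f n) \<le> (C * 2 powr \<bar>s\<bar>) * weight s n"
    unfolding eventually_sequentially
  \<comment> \<open>From 2 on, \<open>n \<le> 2 * (n - 1)\<close>, as \<open>weight_half_le\<close>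
    requires.\<close>
  proof (intro exI[of _ 2] allI impI)
    fix n :: nat assume n: "2 \<le> n"
    have "norm (f n) \<le> C * weight s (n - 1)" using C(2)[of "n - 1"] n by simp
    also have "\<dots> \<le> C * (2 powr \<bar>s\<bar> * weight s n)"
      using n C(1) by (intro mult_left_mono weight_half_le) auto
    finally show "norm (f n) \<le> (C * 2 powr \<bar>s\<bar>) * weight s n" by (simp add: mult.assoc)
  qed
  then show ?thesis by (rule dominated_by_eventuallyI[rotated]) simp
qed

lemma summable_dominated_by_weight:
  fixes f :: "nat \<Rightarrow> 'a::banach"
  assumes "dominated_by f (weight s)" "s < -1"
  shows "summable (\<lambda>n. norm (f n))"
proof -
  obtain C where C: "C > 0" "\<And>n. norm (f n) \<le> C * weight s n"
    using dominated_byE[OF assms(1)] by auto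
  show ?thesis
    by (rule summable_comparison_test'[of "\<lambda>n. C * weight s n" 0])
       (use C summable_weight[OF assms(2)] in \<open>auto intro: summable_mult\<close>)
qed

section \<open>Convolutions and tails of sequences of power size\<close>

text \<open>In \<open>weight (b - 1) = weight (b - a) * weight (a - 1)\<close> the first factor
  increases, so it may be taken at \<open>n\<close>, and the second is summable.\<close>

lemma weight_partial_sums_le:
  assumes "a < (0::real)" "a \<le> b"
  shows "\<exists>K\<ge>0. \<forall>n. weight (a - 1) n * (\<Sum>k\<le>n. weight (b - 1) k) \<le> K * weight (b - 1) n"
proof -
  have sm: "summable (weight (a - 1))" using assms by (intro summable_weight) auto
  have "weight (a - 1) n * (\<Sum>k\<le>n. weight (b - 1) k) \<le> suminf (weight (a - 1)) * weight (b - 1) n" for n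
  proof -
    have "(\<Sum>k\<le>n. weight (b - 1) k) \<le> (\<Sum>k\<le>n. weight (b - a) n * weight (a - 1) k)"
    proof (intro sum_mono)
      fix k assume "k \<in> {..n}"
      then have "weight (b - a) k * weight (a - 1) k \<le> weight (b - a) n * weight (a - 1) k"
        using assms by (intro mult_right_mono weight_mono_index) auto
      then show "weight (b - 1) k \<le> weight (b - a) n * weight (a - 1) k"
        by (simp flip: weight_add)
    qed
    also have "\<dots> = weight (b - a) n * (\<Sum>k\<le>n. weight (a - 1) k)"
      by (simp add: sum_distrib_left)
    also have "\<dots> \<le> weight (b - a) n * suminf (weight (a - 1))"
      by (intro mult_left_mono sum_le_suminf sm) auto
    finally have "weight (a - 1) n * (\<Sum>k\<le>n. weight (b - 1) k)
        \<le> weight (a - 1) n * (weight (b - a) n * suminf (weight (a - 1)))"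
      by (intro mult_left_mono) auto
    also have "\<dots> = suminf (weight (a - 1)) * weight ((a - 1) + (b - a)) n"
      unfolding weight_add by simp
    finally show ?thesis by simp
  qed
  moreover have "suminf (weight (a - 1)) \<ge> 0" by (intro suminf_nonneg sm) auto
  ultimately show ?thesis by blast
qed

text \<open>Cut the sum at \<open>k = n / 2\<close>: the factor with index at least
  \<open>n / 2\<close> is replaced by a multiple of its value at \<open>n\<close>, the other is
  summed. The sums of \<open>weight (a - 1)\<close> converge; those of \<open>weight (b - 1)\<close>
  may grow, but they carry the factor \<open>weight (a - 1) n\<close>.\<close>

lemma weight_convolution:
  assumes "a < (0::real)"
  shows "\<exists>K\<ge>0. \<forall>n. (\<Sum>k\<le>n. weight (a - 1) k * weight (b - 1) (n - k)) \<le> K * (weight (a - 1) n + weight (b - 1) n)"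
proof -
  have sma: "summable (weight (a - 1))" using assms by (intro summable_weight) auto
  have S: "(\<Sum>k\<le>n. weight (a - 1) k) \<le> suminf (weight (a - 1))" for n
    by (intro sum_le_suminf sma) auto
  obtain K1 where K1: "K1 \<ge> 0" "\<And>n. weight (a - 1) n * (\<Sum>k\<le>n. weight (b - 1) k) \<le> K1 * (weight (a - 1) n + weight (b - 1) n)"
  proof (cases "a \<le> b")
    case True
    obtain K where K: "K \<ge> 0" "\<And>n. weight (a - 1) n * (\<Sum>k\<le>n. weight (b - 1) k) \<le> K * weight (b - 1) n"
      using weight_partial_sums_le[OF assms True] by blast
    show thesis
    proof (rule that[OF K(1)])
      fix n
      have "K * weight (b - 1) n \<le> K * (weight (a - 1) n + weight (b - 1) n)"
        using K(1) by (intro mult_left_mono) auto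
      with K(2)[of n] show "weight (a - 1) n * (\<Sum>k\<le>n. weight (b - 1) k) \<le> K * (weight (a - 1) n + weight (b - 1) n)"
        by linarith
    qed
  next
    case False
    then have smb: "summable (weight (b - 1))" using assms by (intro summable_weight) auto
    show thesis
    proof (rule that)
      show "suminf (weight (b - 1)) \<ge> 0" by (intro suminf_nonneg smb) auto
      fix n
      have "weight (a - 1) n * (\<Sum>k\<le>n. weight (b - 1) k) \<le> weight (a - 1) n * suminf (weight (b - 1))"
        by (intro mult_left_mono sum_le_suminf smb) auto
      also have "\<dots> \<le> suminf (weight (b - 1)) * (weight (a - 1) n + weight (b - 1) n)"
        using suminf_nonneg[OF smb] by (simp add: algebra_simps)
      finally show "weight (a - 1) n * (\<Sum>k\<le>n. weight (b - 1) k) \<le> suminf (weight (b - 1)) * (weight (a - 1) n + weight (b - 1) n)" .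
    qed
  qed
  define A where "A = suminf (weight (a - 1))"
  have A: "A \<ge> 0" unfolding A_def by (intro suminf_nonneg sma) auto
  define p where "p = 2 powr \<bar>a - 1\<bar>"
  define q where "q = 2 powr \<bar>b - 1\<bar>"
  have pq: "p \<ge> 0" "q \<ge> 0" by (auto simp: p_def q_def)
  have "(\<Sum>k\<le>n. weight (a - 1) k * weight (b - 1) (n - k)) \<le> (q * A + p * K1) * (weight (a - 1) n + weight (b - 1) n)" for n
  proof -
    have "(\<Sum>k\<le>n. weight (a - 1) k * weight (b - 1) (n - k))
        \<le> (\<Sum>k\<le>n. q * weight (b - 1) n * weight (a - 1) k + p * weight (a - 1) n * weight (b - 1) (n - k))"
    proof (intro sum_mono)
      fix k assume k: "k \<in> {..n}"
      show "weight (a - 1) k * weight (b - 1) (n - k)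
          \<le> q * weight (b - 1) n * weight (a - 1) k + p * weight (a - 1) n * weight (b - 1) (n - k)"
      proof (cases "2 * k \<le> n")
        case True
        have "weight (a - 1) k * weight (b - 1) (n - k) \<le> weight (a - 1) k * (q * weight (b - 1) n)"
          unfolding q_def using True by (intro mult_left_mono weight_half_le) auto
        also have "\<dots> \<le> q * weight (b - 1) n * weight (a - 1) k + p * weight (a - 1) n * weight (b - 1) (n - k)"
          using pq by (simp add: mult_ac)
        finally show ?thesis .
      next
        case False
        have "weight (a - 1) k * weight (b - 1) (n - k) \<le> (p * weight (a - 1) n) * weight (b - 1) (n - k)"
          unfolding p_def using False k by (intro mult_right_mono weight_half_le) auto
        also have "\<dots> \<le> q * weight (b - 1) n * weight (a - 1) k + p * weight (a - 1) n * weight (b - 1) (n - k)"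
          using pq by (simp add: mult_ac)
        finally show ?thesis .
      qed
    qed
    also have "\<dots> = q * (weight (b - 1) n * (\<Sum>k\<le>n. weight (a - 1) k)) + p * (weight (a - 1) n * (\<Sum>k\<le>n. weight (b - 1) (n - k)))"
      by (simp add: sum.distrib sum_distrib_left mult_ac)
    also have "(\<Sum>k\<le>n. weight (b - 1) (n - k)) = (\<Sum>k\<le>n. weight (b - 1) k)"
      by (rule sum.nat_diff_reindex[of "weight (b-1)" "Suc n", unfolded lessThan_Suc_atMost, simplified])
    also have "q * (weight (b - 1) n * (\<Sum>k\<le>n. weight (a - 1) k)) + p * (weight (a - 1) n * (\<Sum>k\<le>n. weight (b - 1) k))
        \<le> q * (weight (b - 1) n * A) + p * (K1 * (weight (a - 1) n + weight (b - 1) n))"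
      using pq S[of n] K1(2)[of n] unfolding A_def by (intro add_mono mult_left_mono) auto
    also have "\<dots> \<le> (q * A + p * K1) * (weight (a - 1) n + weight (b - 1) n)"
      using pq A by (simp add: algebra_simps)
    finally show ?thesis .
  qed
  moreover have "q * A + p * K1 \<ge> 0" using pq A K1 by simp
  ultimately show ?thesis by blast
qed

lemma dominated_by_convolution:
  fixes u v :: "nat \<Rightarrow> complex"
  assumes "dominated_by u (weight (a - 1))" "dominated_by v (weight (b - 1))" "a < 0 \<or> b < 0"
  shows "dominated_by (\<lambda>n. \<Sum>k\<le>n. u k * v (n - k)) (\<lambda>n. weight (a - 1) n + weight (b - 1) n)"
proof -
  have *: "dominated_by (\<lambda>n. \<Sum>k\<le>n. u k * v (n - k)) (\<lambda>n. weight (a - 1) n + weight (b - 1) n)"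
    if uv: "dominated_by u (weight (a - 1))" "dominated_by v (weight (b - 1))" and a: "a < 0"
    for u v :: "nat \<Rightarrow> complex" and a b
  proof -
    obtain C D where C: "C > 0" "\<And>n. norm (u n) \<le> C * weight (a - 1) n"
      and D: "D > 0" "\<And>n. norm (v n) \<le> D * weight (b - 1) n"
      using uv dominated_byE weight_nonneg by metis
    obtain K where K: "K \<ge> 0" "\<And>n. (\<Sum>k\<le>n. weight (a - 1) k * weight (b - 1) (n - k)) \<le> K * (weight (a - 1) n + weight (b - 1) n)"
      using weight_convolution[OF a] by blast
    have "norm (\<Sum>k\<le>n. u k * v (n - k)) \<le> (C * D * K) * (weight (a - 1) n + weight (b - 1) n)" for n
    proof -
      have "norm (\<Sum>k\<le>n. u k * v (n - k)) \<le> (\<Sum>k\<le>n. C * weight (a - 1) k * (D * weight (b - 1) (n - k)))"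
        unfolding norm_mult using C D
        by (intro order.trans[OF norm_sum] sum_mono) (auto simp: norm_mult intro!: mult_mono)
      also have "\<dots> = C * D * (\<Sum>k\<le>n. weight (a - 1) k * weight (b - 1) (n - k))"
        by (simp add: sum_distrib_left mult_ac)
      also have "\<dots> \<le> C * D * (K * (weight (a - 1) n + weight (b - 1) n))"
        using C D K by (intro mult_left_mono) auto
      finally show ?thesis by (simp add: mult_ac)
    qed
    then show ?thesis by (rule dominated_byI)
  qed
  show ?thesis
  proof (cases "a < 0")
    case True
    then show ?thesis using * assms by blast
  next
    case False
    then have "dominated_by (\<lambda>n. \<Sum>k\<le>n. v k * u (n - k)) (\<lambda>n. weight (b - 1) n + weight (a - 1) n)"
      using * assms by blast
    moreover have "(\<Sum>k\<le>n. v k * u (n - k)) = (\<Sum>k\<le>n. u k * v (n - k))" for n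
      using sum.nat_diff_reindex[of "\<lambda>k. u k * v (n - k)" "Suc n", symmetric]
      by (simp add: lessThan_Suc_atMost mult.commute)
    ultimately show ?thesis by (simp add: add.commute)
  qed
qed

text \<open>Pulling out the nonincreasing factor \<open>weight (s + 2)\<close> leaves exponent -2,
  which is dominated by a telescoping sequence. Hence the hypothesis \<open>s \<le> -2\<close>
  instead of mere summability.\<close>

lemma summation_tail:
  fixes u :: "nat \<Rightarrow> 'a::banach"
  assumes "dominated_by u (weight s)" "s \<le> -2"
  shows "dominated_by (\<lambda>n. \<Sum>j. u (j + Suc n)) (weight (s + 1))"
proof -
  obtain C where C: "C > 0" "\<And>n. norm (u n) \<le> C * weight s n"
    using dominated_byE[OF assms(1)] by auto
  have "norm (\<Sum>j. u (j + Suc n)) \<le> C * weight (s + 1) n" for n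
  proof -
    define g where "g j = 1 / real (j + Suc n)" for j
    have "g \<longlonglongrightarrow> 0" unfolding g_def by real_asymp
    from telescope_sums'[OF this]
    have tel: "(\<lambda>j. g j - g (Suc j)) sums g 0" by simp
    have "norm (u (j + Suc n)) \<le> C * weight (s + 2) n * (g j - g (Suc j))" for j
    proof -
      have "weight s (j + Suc n) = weight (s + 2) (j + Suc n) * weight (-2) (j + Suc n)"
        by (simp flip: weight_add)
      also have "\<dots> \<le> weight (s + 2) n * weight (-2) (j + Suc n)"
        using assms(2) by (intro mult_right_mono weight_antimono) auto
      also have "weight (-2) (j + Suc n) \<le> g j - g (Suc j)"
        unfolding weight_def g_def by (simp add: powr_minus powr_numeral divide_simps power2_eq_square)
      finally have "weight s (j + Suc n) \<le> weight (s + 2) n * (g j - g (Suc j))"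
        by simp
      then have "C * weight s (j + Suc n) \<le> C * (weight (s + 2) n * (g j - g (Suc j)))"
        using C(1) by (intro mult_left_mono) auto
      then show ?thesis using C(2)[of "j + Suc n"] by (simp add: mult.assoc)
    qed
    then have "norm (\<Sum>j. u (j + Suc n)) \<le> (\<Sum>j. C * weight (s + 2) n * (g j - g (Suc j)))"
      using tel by (intro norm_suminf_le) (auto intro: summable_mult sums_summable)
    also have "\<dots> = C * weight (s + 2) n * g 0"
      using tel by (simp add: sums_iff suminf_mult)
    also have "g 0 = weight (-1) n" by (simp add: g_def weight_def powr_minus field_simps)
    also have "C * weight (s + 2) n * weight (-1) n = C * weight (s + 1) n"
      by (simp add: mult.assoc add.commute flip: weight_add)
    finally show ?thesis .
  qed
  then show ?thesis by (rule dominated_byI)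
qed

section \<open>Coefficients of powers of linear factors\<close>

text \<open>The coefficient of \<open>X ^ n\<close> in the power -\<gamma> of \<open>1 - X\<close>.
  Its size is \<open>n powr (Re \<gamma> - 1)\<close>, except at nonpositive integers \<gamma>,
  where it vanishes eventually.\<close>

definition neg_binom :: "'a::field_char_0 \<Rightarrow> nat \<Rightarrow> 'a" where
  "neg_binom \<gamma> n = pochhammer \<gamma> n / fact n"

lemma neg_binom_0 [simp]: "neg_binom \<gamma> 0 = 1"
  by (simp add: neg_binom_def)

lemma neg_binom_gbinomial: "neg_binom \<gamma> n = (-1) ^ n * ((-\<gamma>) gchoose n)"
  by (simp add: neg_binom_def gbinomial_pochhammer flip: power_mult_distrib mult.assoc)

lemma neg_binom_Suc: "of_nat (Suc n) * neg_binom \<gamma> (Suc n) = (\<gamma> + of_nat n) * neg_binom \<gamma> n"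
  by (simp add: neg_binom_def pochhammer_Suc field_simps del: of_nat_Suc)

lemma neg_binom_minus_one:
  "of_nat (Suc n) * neg_binom (\<gamma> - 1) (Suc n) = (\<gamma> - 1) * neg_binom \<gamma> n"
  by (simp add: neg_binom_def pochhammer_rec field_simps del: of_nat_Suc)

text \<open>Coefficientwise form of the fact that multiplication by \<open>1 - X\<close> lowers
  \<gamma> by one.\<close>

lemma neg_binom_diff: "neg_binom \<gamma> (Suc n) - neg_binom \<gamma> n = neg_binom (\<gamma> - 1) (Suc n)"
proof -
  have "of_nat (Suc n) * (neg_binom \<gamma> (Suc n) - neg_binom \<gamma> n)
      = of_nat (Suc n) * neg_binom (\<gamma> - 1) (Suc n)"
    unfolding right_diff_distrib neg_binom_minus_one unfolding neg_binom_Suc by (simp add: ring_distribs)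
  then show ?thesis by (simp del: of_nat_Suc)
qed

lemma neg_binom_nonpos_int: "m < n \<Longrightarrow> neg_binom (- of_nat m) n = 0"
  by (simp add: neg_binom_def pochhammer_of_nat_eq_0_lemma)

lemma neg_binom_nonzero:
  assumes "\<gamma> \<notin> \<int>\<^sub>\<le>\<^sub>0"
  shows "neg_binom \<gamma> n \<noteq> 0"
  using assms by (auto simp: neg_binom_def pochhammer_eq_0_iff)

lemma neg_binom_of_real: "neg_binom (complex_of_real \<gamma>) n = of_real (neg_binom \<gamma> n)"
  by (simp add: neg_binom_def pochhammer_of_real)

text \<open>Used three ways: as an upper bound, inverted as a lower bound where
  \<open>rGamma \<gamma>\<close> is nonzero, and to read off coefficients of expansions.\<close>

lemma neg_binom_limit:
  "(\<lambda>n. neg_binom \<gamma> n * of_nat n powr (1 - \<gamma>)) \<longlonglongrightarrow> rGamma (\<gamma>::complex)"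
proof -
  have "(\<lambda>n. ((-\<gamma>) gchoose n) / ((-1)^n / exp ((-\<gamma>+1) * of_real (ln (real n))))) \<longlonglongrightarrow> rGamma \<gamma>"
    using gbinomial_asymptotic[of "-\<gamma>"] by (simp add: rGamma_inverse_Gamma)
  then show ?thesis
  proof (rule Lim_transform_eventually)
    show "\<forall>\<^sub>F n in sequentially. ((-\<gamma>) gchoose n) / ((-1)^n / exp ((-\<gamma>+1) * of_real (ln (real n))))
        = neg_binom \<gamma> n * of_nat n powr (1 - \<gamma>)"
      using eventually_gt_at_top[of 0]
    proof eventually_elim
      case (elim n)
      then have "of_nat n powr (1 - \<gamma>) = exp ((1 - \<gamma>) * of_real (ln (real n)))"
        by (simp add: powr_def Ln_of_nat)
      then show ?case
        by (cases "even n") (simp_all add: neg_binom_gbinomial)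
    qed
  qed
qed

lemma norm_of_nat_powr: "n > 0 \<Longrightarrow> norm ((of_nat n :: complex) powr \<gamma>) = real n powr Re \<gamma>"
  by (simp add: norm_powr_real_powr)

lemma powr_le_weight: "n \<ge> 2 \<Longrightarrow> real n powr s \<le> 2 powr \<bar>s\<bar> * weight s n"
  using weight_half_le[of "n - 1" n s] by (simp add: weight_def)

lemma dominated_by_weightI_powr:
  assumes "\<And>n. n \<ge> 2 \<Longrightarrow> norm (f n) \<le> C * real n powr s"
  shows "dominated_by f (weight s)"
proof -
  have "norm (f n) \<le> (max C 0 * 2 powr \<bar>s\<bar>) * weight s n" if n: "n \<ge> 2" for n
  proof -
    have "norm (f n) \<le> C * real n powr s" using assms n by simp
    also have "\<dots> \<le> max C 0 * real n powr s" by (intro mult_right_mono) auto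
    also have "\<dots> \<le> max C 0 * (2 powr \<bar>s\<bar> * weight s n)"
      using n by (intro mult_left_mono powr_le_weight) auto
    finally show ?thesis by (simp add: mult.assoc)
  qed
  then show ?thesis
    by (intro dominated_by_eventuallyI) (auto simp: eventually_sequentially)
qed

lemma dominated_by_weightI_limit:
  fixes f :: "nat \<Rightarrow> complex"
  assumes "(\<lambda>n. f n * of_nat n powr (- \<gamma>)) \<longlonglongrightarrow> l"
  shows "dominated_by f (weight (Re \<gamma>))"
proof -
  obtain K where K: "K > 0" "\<And>n. norm (f n * of_nat n powr (- \<gamma>)) \<le> K"
    using BseqE[OF convergent_imp_Bseq[OF convergentI[OF assms]]] by blast
  show ?thesis
  proof (rule dominated_by_weightI_powr)
    fix n :: nat assume n: "2 \<le> n"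
    have "norm (f n) * real n powr (- Re \<gamma>) \<le> K"
      using K(2)[of n] n by (simp add: norm_mult norm_of_nat_powr)
    then show "norm (f n) \<le> K * real n powr (Re \<gamma>)"
      using n by (simp add: powr_minus field_simps)
  qed
qed

lemma dominated_by_neg_binom: "dominated_by (neg_binom (\<gamma>::complex)) (weight (Re \<gamma> - 1))"
  using dominated_by_weightI_limit[of "neg_binom \<gamma>" "\<gamma> - 1" "rGamma \<gamma>"] neg_binom_limit[of \<gamma>]
  by simp

definition neg_binom_fps :: "'a::field_char_0 \<Rightarrow> 'a \<Rightarrow> 'a fps" where
  "neg_binom_fps r \<gamma> = Abs_fps (\<lambda>n. r ^ n * neg_binom \<gamma> n)"

lemma neg_binom_fps_nth [simp]: "fps_nth (neg_binom_fps r \<gamma>) n = r ^ n * neg_binom \<gamma> n"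
  by (simp add: neg_binom_fps_def)

text \<open>Compared coefficient by coefficient, this is the Vandermonde identity.\<close>

lemma neg_binom_fps_add: "neg_binom_fps r (\<gamma> + \<delta>) = neg_binom_fps r \<gamma> * neg_binom_fps r \<delta>"
proof (rule fps_ext)
  fix n
  have "fps_nth (neg_binom_fps r \<gamma> * neg_binom_fps r \<delta>) n
      = (\<Sum>k\<le>n. (-r) ^ n * (((-\<gamma>) gchoose k) * ((-\<delta>) gchoose (n - k))))"
    unfolding fps_mult_nth atLeast0AtMost
  proof (intro sum.cong refl)
    fix k assume "k \<in> {..n}"
    then have "(-r) ^ n = (-r) ^ k * (-r) ^ (n - k)" by (simp flip: power_add)
    then show "fps_nth (neg_binom_fps r \<gamma>) k * fps_nth (neg_binom_fps r \<delta>) (n - k)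
        = (-r) ^ n * (((-\<gamma>) gchoose k) * ((-\<delta>) gchoose (n - k)))"
      by (simp add: neg_binom_gbinomial power_minus[of r] mult_ac)
  qed
  also have "\<dots> = (-r) ^ n * ((-\<gamma> + -\<delta>) gchoose n)"
    by (subst gbinomial_Vandermonde[symmetric]) (simp add: sum_distrib_left atLeast0AtMost)
  also have "\<dots> = fps_nth (neg_binom_fps r (\<gamma> + \<delta>)) n"
    by (simp add: neg_binom_gbinomial power_minus[of r])
  finally show "fps_nth (neg_binom_fps r (\<gamma> + \<delta>)) n = fps_nth (neg_binom_fps r \<gamma> * neg_binom_fps r \<delta>) n"
    by simp
qed

lemma neg_binom_fps_minus_one: "neg_binom_fps r (-1) = 1 - fps_const r * fps_X"
proof (rule fps_ext)
  fix n :: nat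
  consider "n = 0" | "n = 1" | "n > 1" by linarith
  then show "fps_nth (neg_binom_fps r (-1)) n = fps_nth (1 - fps_const r * fps_X) n"
  proof cases
    case 3
    then show ?thesis using neg_binom_nonpos_int[of 1 n, where ?'a = 'a] by simp
  qed (auto simp: neg_binom_def)
qed

lemma neg_binom_fps_diff_one: "neg_binom_fps r (\<gamma> - 1) = (1 - fps_const r * fps_X) * neg_binom_fps r \<gamma>"
  using neg_binom_fps_add[of r "-1" \<gamma>] by (simp add: neg_binom_fps_minus_one)

lemma dominated_by_neg_binom_fps:
  assumes "norm (r::complex) \<le> 1"
  shows "dominated_by (fps_nth (neg_binom_fps r \<gamma>)) (weight (Re \<gamma> - 1))"
proof -
  obtain C where C: "\<And>n. norm (neg_binom \<gamma> n) \<le> C * weight (Re \<gamma> - 1) n"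
    using dominated_by_neg_binom[of \<gamma>] unfolding dominated_by_def by blast
  have "norm (fps_nth (neg_binom_fps r \<gamma>) n) \<le> C * weight (Re \<gamma> - 1) n" for n
  proof -
    have "norm (fps_nth (neg_binom_fps r \<gamma>) n) \<le> 1 * norm (neg_binom \<gamma> n)"
      unfolding neg_binom_fps_nth norm_mult norm_power using assms
      by (intro mult_right_mono power_le_one) auto
    with C[of n] show ?thesis by simp
  qed
  then show ?thesis by (rule dominated_byI)
qed

section \<open>Products of powers of \<open>1 - X\<close> and \<open>1 - r X\<close>\<close>

definition two_pole_fps :: "complex \<Rightarrow> complex \<Rightarrow> complex \<Rightarrow> complex fps" where
  "two_pole_fps r \<delta> \<alpha> = neg_binom_fps 1 \<delta> * neg_binom_fps r \<alpha>"

lemma two_pole_fps_rec: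
  "fps_const (1 - r) * two_pole_fps r \<delta> \<alpha> = two_pole_fps r \<delta> (\<alpha> - 1) - fps_const r * two_pole_fps r (\<delta> - 1) \<alpha>"
proof -
  have "fps_const (1 - r) = (1 - fps_const r * fps_X) - fps_const r * (1 - fps_X)"
    by (simp add: algebra_simps flip: fps_const_sub)
  then show ?thesis
    by (simp only: two_pole_fps_def neg_binom_fps_diff_one) (simp add: algebra_simps)
qed

lemma two_pole_nth_rec:
  assumes "r \<noteq> 1"
  shows "fps_nth (two_pole_fps r \<delta> \<alpha>) n =
    (1 / (1 - r)) * (fps_nth (two_pole_fps r \<delta> (\<alpha> - 1)) n - r * fps_nth (two_pole_fps r (\<delta> - 1) \<alpha>) n)"
proof -
  have "(1 - r) * fps_nth (two_pole_fps r \<delta> \<alpha>) n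
      = fps_nth (two_pole_fps r \<delta> (\<alpha> - 1)) n - r * fps_nth (two_pole_fps r (\<delta> - 1) \<alpha>) n"
    using arg_cong[OF two_pole_fps_rec[of r \<delta> \<alpha>], of "\<lambda>f. fps_nth f n"] by simp
  then show ?thesis using assms by (simp add: field_simps)
qed

text \<open>Each use of the recurrence lowers \<open>Re \<delta> + Re \<alpha>\<close> by one. Once
  this sum is negative, one of the real parts is, and the corresponding factor is absolutely
  summable. \<open>m\<close> counts the uses needed.\<close>

lemma dominated_by_two_pole:
  assumes r: "norm r \<le> 1" "r \<noteq> 1"
  shows "dominated_by (fps_nth (two_pole_fps r \<delta> \<alpha>)) (\<lambda>n. weight (Re \<delta> - 1) n + weight (Re \<alpha> - 1) n)"
proof -
  have base: "dominated_by (fps_nth (two_pole_fps r \<delta> \<alpha>)) (\<lambda>n. weight (Re \<delta> - 1) n + weight (Re \<alpha> - 1) n)"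
    if "Re \<delta> < 0 \<or> Re \<alpha> < 0" for \<delta> \<alpha>
    using dominated_by_convolution[OF dominated_by_neg_binom_fps[of 1 \<delta>] dominated_by_neg_binom_fps[OF r(1), of \<alpha>] that]
    unfolding two_pole_fps_def fps_mult_nth[abs_def] atLeast0AtMost by simp
  have "dominated_by (fps_nth (two_pole_fps r \<delta> \<alpha>)) (\<lambda>n. weight (Re \<delta> - 1) n + weight (Re \<alpha> - 1) n)"
    if "Re \<delta> + Re \<alpha> < real m" for m
    using that
  proof (induction m arbitrary: \<delta> \<alpha>)
    case 0
    then show ?case by (intro base) auto
  next
    case (Suc m)
    have 1: "dominated_by (fps_nth (two_pole_fps r \<delta> (\<alpha> - 1))) (\<lambda>n. weight (Re \<delta> - 1) n + weight (Re \<alpha> - 1) n)"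
      by (rule dominated_by_weight2_mono[OF Suc.IH]) (use Suc.prems in auto)
    have 2: "dominated_by (fps_nth (two_pole_fps r (\<delta> - 1) \<alpha>)) (\<lambda>n. weight (Re \<delta> - 1) n + weight (Re \<alpha> - 1) n)"
      by (rule dominated_by_weight2_mono[OF Suc.IH]) (use Suc.prems in auto)
    have "dominated_by (\<lambda>n. (1 / (1 - r)) * (fps_nth (two_pole_fps r \<delta> (\<alpha> - 1)) n - r * fps_nth (two_pole_fps r (\<delta> - 1) \<alpha>) n))
       (\<lambda>n. weight (Re \<delta> - 1) n + weight (Re \<alpha> - 1) n)"
      by (intro dominated_by_cmult dominated_by_diff 1 2)
    then show ?case
      by (rule dominated_by_cong) (rule two_pole_nth_rec[OF r(2)])
  qed
  moreover obtain m where "Re \<delta> + Re \<alpha> < real m" using reals_Archimedean2 by blast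
  ultimately show ?thesis by blast
qed

section \<open>Division by \<open>1 - X\<close> and Abel limits\<close>

text \<open>Subtracting the value at 1 makes the series divisible by \<open>1 - X\<close>. The
  coefficients of the quotient are the negated tails of \<open>u\<close>, so each division costs one
  power of \<open>n\<close>.\<close>

lemma fps_diff_at_one:
  fixes u :: "nat \<Rightarrow> complex"
  assumes "dominated_by u (weight s)" "s \<le> -2"
  obtains w where "dominated_by w (weight (s + 1))"
    "Abs_fps u = fps_const (suminf u) + (1 - fps_X) * Abs_fps w"
proof -
  define w where "w n = - (\<Sum>j. u (j + Suc n))" for n
  have sm: "summable u"
    using summable_dominated_by_weight[OF assms(1)] assms(2) by (auto intro: summable_norm_cancel)
  have w: "w n = (\<Sum>j\<le>n. u j) - suminf u" for n
    unfolding w_def using suminf_split_initial_segment[OF sm, of "Suc n"] by (simp add: lessThan_Suc_atMost)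
  show thesis
  proof (rule that)
    show "dominated_by w (weight (s + 1))"
      using dominated_by_cmult[OF summation_tail[OF assms], of "-1"] by (simp add: w_def[abs_def])
    show "Abs_fps u = fps_const (suminf u) + (1 - fps_X) * Abs_fps w"
    proof (rule fps_ext)
      fix n
      show "fps_nth (Abs_fps u) n = fps_nth (fps_const (suminf u) + (1 - fps_X) * Abs_fps w) n"
        by (cases n) (simp_all add: left_diff_distrib w)
    qed
  qed
qed

text \<open>By the M-test the series converges uniformly on the closed interval, so it is continuous
  up to 1. This identifies the constants split off by \<open>fps_diff_at_one\<close>.\<close>

lemma abel_limit_abs_summable:
  fixes u :: "nat \<Rightarrow> complex"
  assumes "summable (\<lambda>n. norm (u n))"
  shows "((\<lambda>x. \<Sum>n. u n * of_real x ^ n) \<longlongrightarrow> suminf u) (at_left (1::real))"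
proof -
  have "uniform_limit {0..1::real} (\<lambda>N x. \<Sum>n<N. u n * of_real x ^ n) (\<lambda>x. \<Sum>n. u n * of_real x ^ n) sequentially"
    by (rule Weierstrass_m_test[OF _ assms])
       (auto simp: norm_mult norm_power intro!: mult_left_le power_le_one)
  then have "continuous_on {0..1::real} (\<lambda>x. \<Sum>n. u n * of_real x ^ n)"
    by (rule uniform_limit_theorem[rotated]) (auto intro!: always_eventually continuous_intros)
  then have "((\<lambda>x. \<Sum>n. u n * of_real x ^ n) \<longlongrightarrow> (\<Sum>n. u n * of_real 1 ^ n)) (at 1 within {0..1::real})"
    unfolding continuous_on_def by (rule bspec) simp
  then show ?thesis
    by (simp add: at_within_Icc_at_left)
qed

lemma neg_binom_fps_sums:
  assumes "norm (r::complex) \<le> 1" "norm z < 1"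
  shows "(\<lambda>n. fps_nth (neg_binom_fps r \<gamma>) n * z ^ n) sums ((1 - r * z) powr (-\<gamma>))"
proof -
  have "norm (- r * z) \<le> 1 * norm z"
    unfolding norm_mult norm_minus_cancel using assms(1) by (intro mult_right_mono) auto
  then have "norm (- r * z) < 1" using assms(2) by linarith
  from gen_binomial_complex[OF this, of "-\<gamma>"]
  have "(\<lambda>n. (-\<gamma> gchoose n) * (- r * z) ^ n) sums ((1 - r * z) powr (-\<gamma>))" by simp
  moreover have "(-\<gamma> gchoose n) * (- r * z) ^ n = fps_nth (neg_binom_fps r \<gamma>) n * z ^ n" for n
    by (simp add: neg_binom_gbinomial power_mult_distrib power_minus[of "r * z"])
  ultimately show ?thesis by simp
qed

section \<open>Two singular factors\<close>

text \<open>Keeps \<open>1 - r\<close> off the branch cut of \<open>powr\<close>, where the power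
  has to be differentiated.\<close>

lemma Re_one_minus_pos:
  assumes "norm (r::complex) \<le> 1" "r \<noteq> 1"
  shows "Re (1 - r) > 0"
proof (rule ccontr)
  assume "\<not> Re (1 - r) > 0"
  then have "Re r \<ge> 1" by simp
  moreover have "Re r \<le> 1" using complex_Re_le_cmod[of r] assms(1) by linarith
  ultimately have Re: "Re r = 1" by simp
  have "(norm r)\<^sup>2 \<le> 1" using assms(1) by (simp add: power_le_one)
  then have "Im r = 0" using Re by (simp add: cmod_power2)
  with Re assms(2) show False by (simp add: complex_eq_iff)
qed

text \<open>Taylor expansion at \<open>X = 1\<close>, with the second-order remainder kept as a
  power series. \<open>Re \<alpha> < -2\<close> leaves room for two divisions by
  \<open>1 - X\<close>. If \<open>r\<close> has norm 1, the point 1 lies on the circle of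
  convergence, so the value and the derivative there are obtained as limits from the left.\<close>

lemma neg_binom_fps_at_one:
  assumes r: "norm (r::complex) \<le> 1" "r \<noteq> 1" and \<alpha>: "Re \<alpha> < -2"
  obtains w where "dominated_by w (weight (Re \<alpha> + 1))"
    "neg_binom_fps r \<alpha> = fps_const ((1 - r) powr (-\<alpha>)) +
       (1 - fps_X) * (fps_const (- (\<alpha> * r / (1 - r)) * (1 - r) powr (-\<alpha>)) + (1 - fps_X) * Abs_fps w)"
proof -
  define v where "v = fps_nth (neg_binom_fps r \<alpha>)"
  define F where "F z = (1 - r * z) powr (-\<alpha>)" for z
  have v: "dominated_by v (weight (Re \<alpha> - 1))"
    unfolding v_def by (rule dominated_by_neg_binom_fps[OF r(1)])
  obtain w1 where w1: "dominated_by w1 (weight (Re \<alpha>))"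
      "Abs_fps v = fps_const (suminf v) + (1 - fps_X) * Abs_fps w1"
    using fps_diff_at_one[OF v] \<alpha> by auto
  obtain w2 where w2: "dominated_by w2 (weight (Re \<alpha> + 1))"
      "Abs_fps w1 = fps_const (suminf w1) + (1 - fps_X) * Abs_fps w2"
    using fps_diff_at_one[OF w1(1)] \<alpha> by auto
  have sv: "summable (\<lambda>n. norm (v n))" and sw: "summable (\<lambda>n. norm (w1 n))"
    using summable_dominated_by_weight[OF v] summable_dominated_by_weight[OF w1(1)] \<alpha> by auto
  have dF: "(F has_field_derivative (\<alpha> * r * (1 - r) powr (-\<alpha> - 1))) (at 1)"
  proof -
    have "1 - r \<notin> \<real>\<^sub>\<le>\<^sub>0" using Re_one_minus_pos[OF r] by (auto simp: complex_nonpos_Reals_iff)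
    then show ?thesis unfolding F_def
      by (auto intro!: derivative_eq_intros)
  qed
  have of_real_at_left: "filterlim complex_of_real (at 1) (at_left 1)"
  proof (rule filterlim_atI)
    show "(complex_of_real \<longlongrightarrow> 1) (at_left 1)"
      using tendsto_of_real[OF tendsto_ident_at, of "1::real" "{..<1}", where 'a = complex] by simp
    show "\<forall>\<^sub>F x in at_left 1. complex_of_real x \<noteq> 1"
      by (auto simp: eventually_at_filter)
  qed
  have Fsum: "(\<Sum>n. v n * of_real x ^ n) = F (of_real x)" if "x \<in> {0<..<1}" for x
    using neg_binom_fps_sums[OF r(1), of "of_real x" \<alpha>] that
    by (simp add: F_def v_def sums_iff)
  have ev: "\<forall>\<^sub>F x in at_left 1. x \<in> {0<..<1::real}"
    using eventually_at_left[of "0::real" 1] by (auto intro: exI[of _ 0])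
  have V: "suminf v = F 1"
  proof (rule tendsto_unique[OF _ abel_limit_abs_summable[OF sv]])
    have "((\<lambda>x. F (of_real x)) \<longlongrightarrow> F 1) (at_left 1)"
      using filterlim_compose[OF isContD[OF DERIV_isCont[OF dF]] of_real_at_left] .
    then show "((\<lambda>x. \<Sum>n. v n * of_real x ^ n) \<longlongrightarrow> F 1) (at_left 1)"
      by (rule Lim_transform_eventually) (use ev in eventually_elim, simp add: Fsum)
  qed simp
  \<comment> \<open>The quotient series is minus the difference quotient of \<open>F\<close> at 1,
    so its Abel limit is minus the derivative.\<close>
  have wsum: "(\<Sum>n. w1 n * of_real x ^ n) = - ((F (of_real x) - F 1) / (of_real x - 1))"
    if x: "x \<in> {0<..<1}" for x
  proof -
    define S where "S = (\<Sum>n. w1 n * of_real x ^ n)"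
    have "summable (\<lambda>n. w1 n * of_real x ^ n)"
    proof (rule summable_comparison_test'[OF sw, of 0])
      fix n show "norm (w1 n * of_real x ^ n) \<le> norm (w1 n)"
        using x by (simp add: norm_mult norm_power mult_left_le power_le_one)
    qed
    then have S: "(\<lambda>n. w1 n * of_real x ^ n) sums S" by (simp add: S_def summable_sums)
    have vn: "v n = (if n = 0 then F 1 + w1 0 else w1 n - w1 (n - 1))" for n
      using arg_cong[OF w1(2), of "\<lambda>f. fps_nth f n"] V by (cases n) (simp_all add: left_diff_distrib)
    have "(\<lambda>n. w1 (Suc n) * of_real x ^ Suc n) sums (S - w1 0)"
      using S by (subst sums_Suc_iff) simp
    from sums_diff[OF this sums_mult[OF S, of "of_real x"]]
    have "(\<lambda>n. v (Suc n) * of_real x ^ Suc n) sums (S - w1 0 - of_real x * S)"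
      by (simp add: vn algebra_simps)
    then have "(\<lambda>n. v n * of_real x ^ n) sums (S - w1 0 - of_real x * S + v 0)"
      by (subst (asm) sums_Suc_iff) simp
    then have "F (of_real x) = F 1 + (1 - of_real x) * S"
      using Fsum[OF x] by (simp add: sums_iff vn algebra_simps)
    moreover have "complex_of_real x - 1 \<noteq> 0" using x by auto
    ultimately show ?thesis
      unfolding S_def[symmetric] by (simp add: field_simps)
  qed
  have W: "suminf w1 = - (\<alpha> * r * (1 - r) powr (-\<alpha> - 1))"
  proof (rule tendsto_unique[OF _ abel_limit_abs_summable[OF sw]])
    have "((\<lambda>z. (F z - F 1) / (z - 1)) \<longlongrightarrow> \<alpha> * r * (1 - r) powr (-\<alpha> - 1)) (at 1)"
      using dF by (simp add: has_field_derivative_iff)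
    from tendsto_minus[OF filterlim_compose[OF this of_real_at_left]]
    show "((\<lambda>x. \<Sum>n. w1 n * of_real x ^ n) \<longlongrightarrow> - (\<alpha> * r * (1 - r) powr (-\<alpha> - 1))) (at_left 1)"
      by (rule Lim_transform_eventually) (use ev in eventually_elim, simp add: wsum)
  qed simp
  have "(1 - r) powr (-\<alpha> - 1) = (1 - r) powr (-\<alpha>) / (1 - r)"
    using r by (simp add: powr_diff)
  then have W': "suminf w1 = - (\<alpha> * r / (1 - r)) * (1 - r) powr (-\<alpha>)"
    using W by (simp add: field_simps)
  have "Abs_fps v = neg_binom_fps r \<alpha>" by (simp add: v_def fps_nth_inverse)
  then show thesis
    using that[OF w2(1)] w1(2) w2(2) V W' by (simp add: F_def)
qed

section \<open>Two-term expansion of the product\<close>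

text \<open>Multiply the expansion of the second factor by \<open>neg_binom_fps 1 \<delta>\<close>:
  every factor \<open>1 - X\<close> lowers \<delta> by one. The remainder becomes a convolution with
  the absolutely summable \<open>w\<close>.\<close>

lemma two_pole_expansion_base:
  assumes r: "norm r \<le> 1" "r \<noteq> 1" and \<alpha>: "Re \<alpha> < -2"
  shows "dominated_by (\<lambda>n. fps_nth (two_pole_fps r \<delta> \<alpha>) n
            - (1 - r) powr (-\<alpha>) * (neg_binom \<delta> n - \<alpha> * r / (1 - r) * neg_binom (\<delta> - 1) n))
          (\<lambda>n. weight (Re \<delta> - 3) n + weight (Re \<alpha> + 1) n)"
proof -
  define b where "b = (1 - r) powr (-\<alpha>)"
  obtain w where w: "dominated_by w (weight (Re \<alpha> + 1))"
    "neg_binom_fps r \<alpha> = fps_const b + (1 - fps_X) * (fps_const (- (\<alpha> * r / (1 - r)) * b) + (1 - fps_X) * Abs_fps w)"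
    using neg_binom_fps_at_one[OF r \<alpha>] unfolding b_def by blast
  have diff: "(1 - fps_X) * neg_binom_fps 1 \<gamma> = neg_binom_fps 1 (\<gamma> - 1)" for \<gamma> :: complex
    using neg_binom_fps_diff_one[of 1 \<gamma>] by simp
  have diff2: "(1 - fps_X) * ((1 - fps_X) * neg_binom_fps 1 \<delta>) = neg_binom_fps 1 (\<delta> - 2)"
    unfolding diff by (simp add: diff_diff_eq)
  have "two_pole_fps r \<delta> \<alpha> = fps_const b * neg_binom_fps 1 \<delta>
      + fps_const (- (\<alpha> * r / (1 - r)) * b) * ((1 - fps_X) * neg_binom_fps 1 \<delta>)
      + ((1 - fps_X) * ((1 - fps_X) * neg_binom_fps 1 \<delta>)) * Abs_fps w"
    unfolding two_pole_fps_def w(2) by (simp add: ring_distribs mult_ac)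
  then have T: "two_pole_fps r \<delta> \<alpha> = fps_const b * neg_binom_fps 1 \<delta>
      + fps_const (- (\<alpha> * r / (1 - r)) * b) * neg_binom_fps 1 (\<delta> - 1)
      + neg_binom_fps 1 (\<delta> - 2) * Abs_fps w"
    unfolding diff2 unfolding diff .
  have "fps_nth (two_pole_fps r \<delta> \<alpha>) n = b * neg_binom \<delta> n
      + (- (\<alpha> * r / (1 - r)) * b) * neg_binom (\<delta> - 1) n
      + (\<Sum>k\<le>n. neg_binom (\<delta> - 2) k * w (n - k))" for n
    unfolding T by (simp add: fps_mult_nth[of "neg_binom_fps 1 (\<delta> - 2)"] atLeast0AtMost)
  then have eq: "fps_nth (two_pole_fps r \<delta> \<alpha>) n
      - b * (neg_binom \<delta> n - \<alpha> * r / (1 - r) * neg_binom (\<delta> - 1) n)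
      = (\<Sum>k\<le>n. neg_binom (\<delta> - 2) k * w (n - k))" for n
    by (simp add: algebra_simps)
  have "dominated_by (\<lambda>n. \<Sum>k\<le>n. neg_binom (\<delta> - 2) k * w (n - k))
    (\<lambda>n. weight ((Re \<delta> - 2) - 1) n + weight ((Re \<alpha> + 2) - 1) n)"
    by (rule dominated_by_convolution) (use dominated_by_neg_binom[of "\<delta> - 2"] w(1) \<alpha> in \<open>simp_all add: add.commute\<close>)
  then show ?thesis unfolding eq[unfolded b_def] by (simp add: add.commute)
qed

text \<open>The error at \<open>(\<delta>, \<alpha>)\<close> is made of the error at
  \<open>(\<delta>, \<alpha> - 1)\<close>, which is given, and that at
  \<open>(\<delta> - 1, \<alpha>)\<close>, obtained by induction. The descent in \<delta> ends when
  \<open>Re \<delta> - 1 \<le> e\<close>, where each term separately is within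
  \<open>weight e\<close>. Keeping \<open>e\<close> apart from \<alpha> lets repeated steps use the
  same error bound.\<close>

lemma two_pole_expansion_step:
  assumes r: "norm r \<le> 1" "r \<noteq> 1" and e: "Re \<alpha> - 1 \<le> e"
    and prev: "\<And>\<delta>. dominated_by (\<lambda>n. fps_nth (two_pole_fps r \<delta> (\<alpha> - 1)) n
            - (1 - r) powr (-(\<alpha> - 1)) * (neg_binom \<delta> n - (\<alpha> - 1) * r / (1 - r) * neg_binom (\<delta> - 1) n))
          (\<lambda>n. weight (Re \<delta> - 3) n + weight e n)"
  shows "dominated_by (\<lambda>n. fps_nth (two_pole_fps r \<delta> \<alpha>) n
            - (1 - r) powr (-\<alpha>) * (neg_binom \<delta> n - \<alpha> * r / (1 - r) * neg_binom (\<delta> - 1) n))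
          (\<lambda>n. weight (Re \<delta> - 3) n + weight e n)"
proof -
  define b where "b = (1 - r) powr (-\<alpha>)"
  have b': "(1 - r) powr (-(\<alpha> - 1)) = (1 - r) * b"
    using powr_add[of "1 - r" "-\<alpha>" 1] r by (simp add: b_def)
  define E where "E \<delta> n = fps_nth (two_pole_fps r \<delta> \<alpha>) n
            - b * (neg_binom \<delta> n - \<alpha> * r / (1 - r) * neg_binom (\<delta> - 1) n)" for \<delta> n
  define E' where "E' \<delta> n = fps_nth (two_pole_fps r \<delta> (\<alpha> - 1)) n
            - (1 - r) * b * (neg_binom \<delta> n - (\<alpha> - 1) * r / (1 - r) * neg_binom (\<delta> - 1) n)" for \<delta> n
  \<comment> \<open>The coefficients of \<open>neg_binom (\<delta> - 1)\<close> agree because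
    \<open>(\<alpha> - 1) * r + r = \<alpha> * r\<close>. Only a multiple of
    \<open>neg_binom (\<delta> - 2)\<close> is left over, of the size of the first error
    term.\<close>
  have rec: "E \<delta> n = (1 / (1 - r)) * (E' \<delta> n - r * E (\<delta> - 1) n) + (b * r / (1 - r) * (\<alpha> * r / (1 - r))) * neg_binom (\<delta> - 2) n" for \<delta> n
  proof -
    have "(1 - r) * E \<delta> n = E' \<delta> n - r * E (\<delta> - 1) n + b * r * (\<alpha> * r / (1 - r)) * neg_binom (\<delta> - 2) n"
      unfolding E_def E'_def two_pole_nth_rec[OF r(2), of \<delta> \<alpha>] using r(2)
      by (simp add: divide_simps) (simp add: algebra_simps)
    then show ?thesis using r(2) by (simp add: divide_simps) (simp add: algebra_simps)
  qed
  have "dominated_by (E \<delta>) (\<lambda>n. weight (Re \<delta> - 3) n + weight e n)" if "Re \<delta> - 1 \<le> e + real m" for m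
    using that
  proof (induction m arbitrary: \<delta>)
    case 0
    have "weight (Re \<delta> - 1) n + weight (Re \<alpha> - 1) n \<le> 2 * weight e n" for n
      using weight_mono[of "Re \<delta> - 1" e n] weight_mono[of "Re \<alpha> - 1" e n] 0 e by simp
    then have "dominated_by (fps_nth (two_pole_fps r \<delta> \<alpha>)) (weight e)"
      by (intro dominated_by_mono[OF dominated_by_two_pole[OF r], where K = 2] add_nonneg_nonneg weight_nonneg)
    moreover have "dominated_by (neg_binom \<delta>) (weight e)"
      by (rule dominated_by_weight_mono[OF dominated_by_neg_binom]) (use 0 in auto)
    moreover have "dominated_by (neg_binom (\<delta> - 1)) (weight e)"
      by (rule dominated_by_weight_mono[OF dominated_by_neg_binom]) (use 0 in auto)
    ultimately have "dominated_by (E \<delta>) (weight e)"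
      unfolding E_def[abs_def] by (intro dominated_by_diff dominated_by_cmult)
    then show ?case by (rule dominated_by_weight2I2) simp
  next
    case (Suc m)
    have 1: "dominated_by (E' \<delta>) (\<lambda>n. weight (Re \<delta> - 3) n + weight e n)"
      using prev[of \<delta>] unfolding b' E'_def[abs_def] .
    have 2: "dominated_by (E (\<delta> - 1)) (\<lambda>n. weight (Re \<delta> - 3) n + weight e n)"
      by (rule dominated_by_weight2_mono[OF Suc.IH]) (use Suc.prems in auto)
    have 3: "dominated_by (neg_binom (\<delta> - 2)) (\<lambda>n. weight (Re \<delta> - 3) n + weight e n)"
      by (rule dominated_by_weight2I1[OF dominated_by_neg_binom]) auto
    show ?case
      by (rule dominated_by_cong[OF _ rec]) (intro dominated_by_add dominated_by_diff dominated_by_cmult 1 2 3)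
  qed
  moreover obtain m where "Re \<delta> - 1 - e \<le> real m" using real_arch_simple by blast
  ultimately show ?thesis unfolding E_def[abs_def] b_def by (simp add: algebra_simps)
qed

lemma two_pole_expansion:
  assumes r: "norm r \<le> 1" "r \<noteq> 1"
  shows "dominated_by (\<lambda>n. fps_nth (two_pole_fps r \<delta> \<alpha>) n
            - (1 - r) powr (-\<alpha>) * (neg_binom \<delta> n - \<alpha> * r / (1 - r) * neg_binom (\<delta> - 1) n))
          (\<lambda>n. weight (Re \<delta> - 3) n + weight (Re \<alpha> - 1) n)"
proof -
  \<comment> \<open>Far enough down for the base case. Moreover \<open>p \<ge> 2\<close> ensures
    that its error exponent \<open>Re \<alpha> - p + 1\<close> does not exceed
    \<open>Re \<alpha> - 1\<close>, the exponent kept through the \<open>p\<close> steps back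
    up.\<close>
  define p where "p = nat \<lceil>\<bar>Re \<alpha>\<bar>\<rceil> + 3"
  have p: "Re \<alpha> - real p < -2" "p \<ge> 2" unfolding p_def by linarith+
  have "dominated_by (\<lambda>n. fps_nth (two_pole_fps r \<delta> \<beta>) n
            - (1 - r) powr (-\<beta>) * (neg_binom \<delta> n - \<beta> * r / (1 - r) * neg_binom (\<delta> - 1) n))
          (\<lambda>n. weight (Re \<delta> - 3) n + weight (Re \<alpha> - 1) n)"
    if "\<beta> = \<alpha> - of_nat p + of_nat i" "i \<le> p" for i \<beta> \<delta>
    using that
  proof (induction i arbitrary: \<beta> \<delta>)
    case 0
    show ?case
      by (rule dominated_by_weight2_mono[OF two_pole_expansion_base[OF r]]) (use 0 p in auto)
  next
    case (Suc i)
    show ?case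
      by (rule two_pole_expansion_step[OF r _ Suc.IH]) (use Suc.prems in auto)
  qed
  from this[of \<alpha> p] show ?thesis by simp
qed

section \<open>Expansion of power functions\<close>

text \<open>For identities that fail at \<open>n = 0\<close>, where \<open>0 powr \<beta>\<close> is
  0, \<open>neg_binom \<gamma> 0\<close> is 1 and \<open>n - 1\<close> is truncated.\<close>

lemma dominated_by_cong_positive:
  assumes "dominated_by f g" "\<And>n. g n > 0" "\<And>n. n \<ge> 1 \<Longrightarrow> f' n = f n"
  shows "dominated_by f' g"
proof -
  obtain C where C: "\<And>n. norm (f n) \<le> C * g n"
    using assms(1) unfolding dominated_by_def by blast
  have "\<forall>\<^sub>F n in sequentially. norm (f' n) \<le> C * g n"
    unfolding eventually_sequentially using C assms(3) by (intro exI[of _ 1]) auto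
  then show ?thesis by (rule dominated_by_eventuallyI[OF assms(2)])
qed

lemma dominated_by_powr: "dominated_by (\<lambda>n. (of_nat n :: complex) powr \<beta>) (weight (Re \<beta>))"
  by (rule dominated_by_weightI_powr[where C = 1]) (simp add: norm_of_nat_powr)

lemma dominated_by_imp_limit_zero:
  assumes "dominated_by f (weight s)" "s < Re \<gamma>"
  shows "(\<lambda>n. f n * (of_nat n :: complex) powr (-\<gamma>)) \<longlonglongrightarrow> 0"
proof -
  obtain C where C: "C > 0" "\<And>n. norm (f n) \<le> C * weight s n"
    using dominated_byE[OF assms(1)] by auto
  have lim: "(\<lambda>n. C * real (Suc n) powr s * real n powr (- Re \<gamma>)) \<longlonglongrightarrow> 0"
    using assms(2) C(1) by real_asymp
  have le: "norm (f n * (of_nat n :: complex) powr (-\<gamma>)) \<le> C * real (Suc n) powr s * real n powr (- Re \<gamma>)"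
    if "n > 0" for n
    using C(2)[of n] that by (simp add: norm_mult norm_of_nat_powr weight_def mult_right_mono)
  show ?thesis
    by (rule Lim_null_comparison[OF eventually_mono[OF eventually_gt_at_top[of 0] le] lim])
qed

text \<open>An asymptotic expansion with \<open>N\<close> terms: the error has the size of the first
  omitted basis element, \<open>neg_binom (\<beta> + 1 - of_nat N)\<close>.\<close>

definition neg_binom_expandable :: "(nat \<Rightarrow> complex) \<Rightarrow> complex \<Rightarrow> nat \<Rightarrow> bool" where
  "neg_binom_expandable f \<beta> N \<longleftrightarrow>
    (\<exists>a. dominated_by (\<lambda>n. f n - (\<Sum>k<N. a k * neg_binom (\<beta> + 1 - of_nat k) n)) (weight (Re \<beta> - real N)))"

lemma expandable_dominated_by:
  "dominated_by f (weight (Re \<beta> - real N)) \<Longrightarrow> neg_binom_expandable f \<beta> N"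
  unfolding neg_binom_expandable_def by (intro exI[of _ "\<lambda>_. 0"]) simp

lemma expandable_add:
  assumes "neg_binom_expandable f \<beta> N" "neg_binom_expandable g \<beta> N"
  shows "neg_binom_expandable (\<lambda>n. f n + g n) \<beta> N"
proof -
  obtain a b where
    "dominated_by (\<lambda>n. f n - (\<Sum>k<N. a k * neg_binom (\<beta> + 1 - of_nat k) n)) (weight (Re \<beta> - real N))"
    "dominated_by (\<lambda>n. g n - (\<Sum>k<N. b k * neg_binom (\<beta> + 1 - of_nat k) n)) (weight (Re \<beta> - real N))"
    using assms unfolding neg_binom_expandable_def by blast
  from dominated_by_add[OF this] show ?thesis
    unfolding neg_binom_expandable_def
    by (intro exI[of _ "\<lambda>k. a k + b k"]) (simp add: ring_distribs sum.distrib add_diff_add)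
qed

lemma expandable_cmult:
  assumes "neg_binom_expandable f \<beta> N"
  shows "neg_binom_expandable (\<lambda>n. c * f n) \<beta> N"
proof -
  obtain a where
    "dominated_by (\<lambda>n. f n - (\<Sum>k<N. a k * neg_binom (\<beta> + 1 - of_nat k) n)) (weight (Re \<beta> - real N))"
    using assms unfolding neg_binom_expandable_def by blast
  from dominated_by_cmult[OF this, of c] show ?thesis
    unfolding neg_binom_expandable_def
    by (intro exI[of _ "\<lambda>k. c * a k"]) (simp add: right_diff_distrib sum_distrib_left mult.assoc)
qed

lemma expandable_sum:
  assumes "\<And>i. i \<in> I \<Longrightarrow> neg_binom_expandable (f i) \<beta> N"
  shows "neg_binom_expandable (\<lambda>n. \<Sum>i\<in>I. f i n) \<beta> N"
  using assms
proof (induction I rule: infinite_finite_induct)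
  case (insert i I)
  then show ?case using expandable_add[of "f i" \<beta> N "\<lambda>n. \<Sum>i\<in>I. f i n"] by simp
qed (simp_all add: expandable_dominated_by dominated_by_zero)

lemma expandable_basis:
  "neg_binom_expandable (\<lambda>n. \<Sum>k<N. a k * neg_binom (\<beta> + 1 - of_nat k) n) \<beta> N"
  unfolding neg_binom_expandable_def by (intro exI[of _ a]) (simp add: dominated_by_zero)

text \<open>The basis for \<open>\<beta> - 1\<close> is the basis for \<beta> without its first
  element; padding with a zero coefficient gains one term.\<close>

lemma expandable_shift:
  assumes "neg_binom_expandable f (\<beta> - 1) N"
  shows "neg_binom_expandable f \<beta> (Suc N)"
proof -
  obtain a where
    a: "dominated_by (\<lambda>n. f n - (\<Sum>k<N. a k * neg_binom (\<beta> - 1 + 1 - of_nat k) n)) (weight (Re (\<beta> - 1) - real N))"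
    using assms unfolding neg_binom_expandable_def by blast
  have "(\<Sum>k<Suc N. (case k of 0 \<Rightarrow> 0 | Suc j \<Rightarrow> a j) * neg_binom (\<beta> + 1 - of_nat k) n)
      = (\<Sum>k<N. a k * neg_binom (\<beta> - 1 + 1 - of_nat k) n)" for n
    unfolding sum.lessThan_Suc_shift by simp
  then show ?thesis
    unfolding neg_binom_expandable_def using a
    by (intro exI[of _ "\<lambda>k. case k of 0 \<Rightarrow> 0 | Suc j \<Rightarrow> a j"]) (simp add: algebra_simps)
qed

lemma expandable_drop:
  assumes "neg_binom_expandable f \<beta> (Suc N)"
  shows "neg_binom_expandable f \<beta> N"
proof -
  obtain a where
    a: "dominated_by (\<lambda>n. f n - (\<Sum>k<Suc N. a k * neg_binom (\<beta> + 1 - of_nat k) n)) (weight (Re \<beta> - real (Suc N)))"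
    using assms unfolding neg_binom_expandable_def by blast
  have 1: "dominated_by (\<lambda>n. f n - (\<Sum>k<Suc N. a k * neg_binom (\<beta> + 1 - of_nat k) n)) (weight (Re \<beta> - real N))"
    by (rule dominated_by_weight_mono[OF a]) simp
  have 2: "dominated_by (\<lambda>n. a N * neg_binom (\<beta> + 1 - of_nat N) n) (weight (Re \<beta> - real N))"
    using dominated_by_cmult[OF dominated_by_neg_binom[of "\<beta> + 1 - of_nat N"], of "a N"] by simp
  from dominated_by_add[OF 1 2] show ?thesis
    unfolding neg_binom_expandable_def by (intro exI[of _ a]) (simp add: algebra_simps)
qed

lemma expandable_mono:
  assumes "neg_binom_expandable f (\<beta> - of_nat j) N"
  shows "neg_binom_expandable f \<beta> N"
  using assms
proof (induction j arbitrary: \<beta>)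
  case (Suc j)
  have "neg_binom_expandable f (\<beta> - 1) N"
    by (rule Suc.IH) (use Suc.prems in \<open>simp add: diff_diff_eq add.commute\<close>)
  then show ?case by (rule expandable_drop[OF expandable_shift])
qed simp

section \<open>The recurrence operator and its action on powers\<close>

text \<open>For \<open>n \<ge> 1\<close> this is the coefficient of \<open>X ^ n\<close> in
  \<open>X * ((1 - X) * F' - (\<beta> + 1) * F)\<close>, with \<open>F\<close> the generating
  function of \<open>f\<close>; the power -\<beta> - 1 of \<open>1 - X\<close> is annihilated. At
  \<open>n = 0\<close> the truncated \<open>n - 1\<close> gives a meaningless value, so identities
  are stated for \<open>n \<ge> 1\<close>.\<close>

definition euler_op :: "complex \<Rightarrow> (nat \<Rightarrow> complex) \<Rightarrow> nat \<Rightarrow> complex" where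
  "euler_op \<beta> f n = of_nat n * f n - (of_nat n + \<beta>) * f (n - 1)"

lemma euler_op_diff: "euler_op \<beta> (\<lambda>n. f n - g n) n = euler_op \<beta> f n - euler_op \<beta> g n"
  by (simp add: euler_op_def algebra_simps)

lemma euler_op_sum_cmult: "euler_op \<beta> (\<lambda>n. \<Sum>i\<in>I. a i * f i n) n = (\<Sum>i\<in>I. a i * euler_op \<beta> (f i) n)"
  by (simp add: euler_op_def sum_distrib_left sum_subtractf right_diff_distrib mult_ac)

text \<open>With \<open>c = 0, 1, 2, ...\<close> the operator is bidiagonal on the basis with
  diagonal entries \<open>-c\<close>. It kills the leading element and can be inverted on the
  others.\<close>

lemma euler_op_neg_binom:
  assumes "n \<ge> 1"
  shows "euler_op \<beta> (neg_binom (\<beta> + 1 - c)) n = - c * (neg_binom (\<beta> + 1 - c) n - neg_binom (\<beta> - c) n)"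
proof -
  obtain m where n: "n = Suc m" using assms by (cases n) auto
  have 1: "of_nat (Suc m) * neg_binom (\<beta> + 1 - c) (Suc m) = (\<beta> + 1 - c + of_nat m) * neg_binom (\<beta> + 1 - c) m"
    by (rule neg_binom_Suc)
  have 2: "neg_binom (\<beta> + 1 - c) (Suc m) - neg_binom (\<beta> + 1 - c) m = neg_binom (\<beta> - c) (Suc m)"
    using neg_binom_diff[of "\<beta> + 1 - c" m] by simp
  have "neg_binom (\<beta> + 1 - c) (Suc m) - neg_binom (\<beta> - c) (Suc m) = neg_binom (\<beta> + 1 - c) m"
    unfolding 2[symmetric] by simp
  then show ?thesis
    unfolding n euler_op_def 1 by (simp add: algebra_simps)
qed

lemma dominated_by_euler_op:
  assumes "dominated_by f (weight s)"
  shows "dominated_by (euler_op \<beta> f) (weight (s + 1))"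
proof -
  have n: "dominated_by (\<lambda>n. of_nat n :: complex) (weight 1)"
    by (rule dominated_by_weightI_powr[where C = 1]) simp
  have nb: "dominated_by (\<lambda>n. of_nat n + \<beta>) (weight 1)"
    by (rule dominated_by_add[OF n dominated_by_weight_mono[of _ 0]])
       (auto intro: dominated_byI[of _ "norm \<beta>"])
  have f': "dominated_by (\<lambda>n. f (n - 1)) (weight s)"
    by (rule dominated_by_weight_SucD) (use assms in simp)
  have "dominated_by (\<lambda>n. of_nat n * f n - (of_nat n + \<beta>) * f (n - 1)) (\<lambda>n. weight 1 n * weight s n)"
    by (intro dominated_by_diff dominated_by_mult n nb f' assms weight_nonneg)
  then show ?thesis
    unfolding euler_op_def[abs_def] by (simp add: add.commute flip: weight_add)
qed

text \<open>The remainder is \<open>z ^ M\<close> times a series that converges absolutely for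
  \<open>norm z \<le> 1/2\<close>. That radius is enough, as \<open>z\<close> will be
  \<open>1 / n\<close> with \<open>n \<ge> 2\<close>.\<close>

lemma power_series_remainder:
  fixes e :: "nat \<Rightarrow> complex"
  assumes "\<And>z. norm z < 1 \<Longrightarrow> (\<lambda>i. e i * z ^ i) sums h z"
  shows "\<exists>C. \<forall>z. norm z \<le> 1/2 \<longrightarrow> norm (h z - (\<Sum>i<M. e i * z ^ i)) \<le> C * norm z ^ M"
proof -
  have "summable (\<lambda>i. norm (e i * (1/2) ^ i))"
  proof (rule powser_insidea)
    \<comment> \<open>Convergence at a point strictly beyond \<open>1/2\<close> gives absolute
      convergence at \<open>1/2\<close>.\<close>
    show "summable (\<lambda>i. e i * (3/4) ^ i)" using assms[of "3/4"] by (simp add: sums_iff)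
  qed simp
  then have "summable (\<lambda>i. norm (e (i + M) * (1/2) ^ (i + M)))"
    by (rule summable_ignore_initial_segment)
  then have "summable (\<lambda>i. 2 ^ M * norm (e (i + M) * (1/2) ^ (i + M)))"
    by (rule summable_mult)
  then have sm: "summable (\<lambda>i. norm (e (i + M)) * (1/2) ^ i)"
    by (simp add: norm_mult norm_divide norm_power power_add power_divide field_simps)
  have "norm (h z - (\<Sum>i<M. e i * z ^ i)) \<le> (\<Sum>i. norm (e (i + M)) * (1/2) ^ i) * norm z ^ M"
    if z: "norm z \<le> 1/2" for z
  proof -
    have s: "(\<lambda>i. e i * z ^ i) sums h z" using assms[of z] z by simp
    have "(\<lambda>i. e (i + M) * z ^ (i + M)) sums (h z - (\<Sum>i<M. e i * z ^ i))"
      using s by (subst sums_iff_shift) simp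
    then have eq: "h z - (\<Sum>i<M. e i * z ^ i) = (\<Sum>i. e (i + M) * z ^ (i + M))"
      by (simp add: sums_iff)
    have "norm (\<Sum>i. e (i + M) * z ^ (i + M)) \<le> (\<Sum>i. norm (e (i + M)) * (1/2) ^ i * norm z ^ M)"
    proof (rule norm_suminf_le)
      fix i
      have "norm z ^ i \<le> (1/2) ^ i" using z by (intro power_mono) auto
      then show "norm (e (i + M) * z ^ (i + M)) \<le> norm (e (i + M)) * (1/2) ^ i * norm z ^ M"
        by (simp add: norm_mult norm_power power_add mult_left_mono mult_right_mono flip: mult.assoc)
    qed (use sm in \<open>simp add: summable_mult2\<close>)
    then show ?thesis using eq sm by (simp add: suminf_mult2)
  qed
  then show ?thesis by blast
qed

text \<open>Taylor coefficients of \<open>1 - (1 + \<beta> * z) * (1 - z) powr \<beta>\<close>. At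
  \<open>z = 1 / n\<close> this function is \<open>n powr (- \<beta> - 1)\<close> times the image of
  \<open>n powr \<beta>\<close> under \<open>euler_op \<beta>\<close>.\<close>

definition euler_coeff :: "complex \<Rightarrow> nat \<Rightarrow> complex" where
  "euler_coeff \<beta> i = fps_nth (1 - (1 + fps_const \<beta> * fps_X) * neg_binom_fps 1 (-\<beta>)) i"

text \<open>Because of the two zeros, the image of \<open>n powr \<beta>\<close> has order
  \<open>\<beta> - 1\<close> instead of the expected \<open>\<beta> + 1\<close>. The third value
  determines the second coefficient of the expansion.\<close>

lemma euler_coeff_values:
  "euler_coeff \<beta> 0 = 0" "euler_coeff \<beta> (Suc 0) = 0" "euler_coeff \<beta> 2 = \<beta> * (\<beta> + 1) / 2"
  by (simp_all add: euler_coeff_def ring_distribs neg_binom_def mult.assoc numeral_2_eq_2 pochhammer_Suc)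
     (simp add: field_simps)

lemma euler_coeff_sums:
  assumes "norm z < 1"
  shows "(\<lambda>i. euler_coeff \<beta> i * z ^ i) sums (1 - (1 + \<beta> * z) * (1 - z) powr \<beta>)"
proof -
  define g where "g i = neg_binom (-\<beta>) i" for i
  have s: "(\<lambda>i. g i * z ^ i) sums ((1 - z) powr \<beta>)"
    using neg_binom_fps_sums[of 1 z "-\<beta>"] assms by (simp add: g_def)
  have "(\<lambda>i. (if Suc i = 0 then 0 else g (Suc i - 1)) * z ^ Suc i) sums (z * (1 - z) powr \<beta>)"
    using sums_mult[OF s, of z] by (simp add: mult_ac)
  then have s': "(\<lambda>i. (if i = 0 then 0 else g (i - 1)) * z ^ i) sums (z * (1 - z) powr \<beta>)"
    by (subst (asm) sums_Suc_iff) simp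
  have one: "(\<lambda>i. if i = 0 then 1 else 0) sums (1::complex)"
    using sums_single[of 0 "\<lambda>_. 1 :: complex"] by (simp add: eq_commute)
  have "(\<lambda>i. (if i = 0 then 1 else 0) - (g i * z ^ i + \<beta> * ((if i = 0 then 0 else g (i - 1)) * z ^ i))) sums
      (1 - ((1 - z) powr \<beta> + \<beta> * (z * (1 - z) powr \<beta>)))"
    by (intro sums_diff sums_add sums_mult one s s')
  moreover have "(if i = 0 then 1 else 0) - (g i * z ^ i + \<beta> * ((if i = 0 then 0 else g (i - 1)) * z ^ i))
      = euler_coeff \<beta> i * z ^ i" for i
    by (cases i) (simp_all add: euler_coeff_def g_def ring_distribs mult.assoc)
  ultimately show ?thesis by (simp add: algebra_simps)
qed

lemma euler_op_powr:
  "dominated_by (\<lambda>n. euler_op \<beta> (\<lambda>n. of_nat n powr \<beta>) n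
      - (\<Sum>j<N. euler_coeff \<beta> (j + 2) * of_nat n powr (\<beta> - 1 - of_nat j))) (weight (Re \<beta> - 1 - real N))"
proof -
  define h where "h z = 1 - (1 + \<beta> * z) * (1 - z) powr \<beta>" for z
  obtain C where C: "\<And>z. norm z \<le> 1/2 \<Longrightarrow> norm (h z - (\<Sum>i<N + 2. euler_coeff \<beta> i * z ^ i)) \<le> C * norm z ^ (N + 2)"
    using power_series_remainder[of "euler_coeff \<beta>" h "N + 2"] euler_coeff_sums unfolding h_def by blast
  show ?thesis
  proof (rule dominated_by_weightI_powr)
    fix n :: nat assume n: "n \<ge> 2"
    define x :: complex where "x = 1 / of_nat n"
    define p :: complex where "p = of_nat n powr (\<beta> + 1)"
    have n0: "(of_nat n :: complex) \<noteq> 0" using n by simp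
    have pn: "of_nat n * of_nat n powr \<beta> = p"
      using n0 by (simp add: p_def powr_add)
    have "(of_nat (n - 1) :: complex) = of_nat n * (1 - x)"
      using n by (simp add: x_def of_nat_diff field_simps)
    moreover have "(of_nat n * (1 - x)) powr \<beta> = of_nat n powr \<beta> * (1 - x) powr \<beta>"
    proof (rule powr_times_real)
      have x: "x = of_real (1 / real n)" by (simp add: x_def)
      show "1 - x \<in> \<real>" unfolding x by simp
      show "0 \<le> Re (1 - x)" unfolding x using n by simp
    qed auto
    ultimately have pm: "of_nat (n - 1) powr \<beta> = of_nat n powr \<beta> * (1 - x) powr \<beta>" by simp
    have L: "euler_op \<beta> (\<lambda>n. of_nat n powr \<beta>) n = p * h x"
      unfolding euler_op_def pm h_def pn[symmetric] using n0 by (simp add: x_def field_simps)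
    have "(\<Sum>j<N. euler_coeff \<beta> (j + 2) * of_nat n powr (\<beta> - 1 - of_nat j))
        = (\<Sum>j<N. p * (euler_coeff \<beta> (j + 2) * x ^ (j + 2)))"
    proof (intro sum.cong refl)
      fix j
      have "of_nat n powr (\<beta> - 1 - of_nat j) = of_nat n powr (\<beta> + 1 - of_nat (j + 2))"
        by (simp add: algebra_simps)
      also have "\<dots> = p * x ^ (j + 2)"
        using n by (simp only: powr_diff p_def x_def powr_nat) (simp add: power_divide)
      finally show "euler_coeff \<beta> (j + 2) * of_nat n powr (\<beta> - 1 - of_nat j) = p * (euler_coeff \<beta> (j + 2) * x ^ (j + 2))"
        by simp
    qed
    \<comment> \<open>The two additional terms at the start vanish by
      \<open>euler_coeff_values\<close>.\<close>
    also have "\<dots> = p * (\<Sum>i<N + 2. euler_coeff \<beta> i * x ^ i)"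
      by (simp add: sum.lessThan_Suc_shift euler_coeff_values sum_distrib_left del: sum.lessThan_Suc)
    finally have S: "(\<Sum>j<N. euler_coeff \<beta> (j + 2) * of_nat n powr (\<beta> - 1 - of_nat j))
        = p * (\<Sum>i<N + 2. euler_coeff \<beta> i * x ^ i)" .
    have nx: "norm x = real n powr (-1)" using n by (simp add: x_def norm_divide powr_minus field_simps)
    also have "\<dots> \<le> 1/2" using n by (simp add: powr_minus field_simps)
    finally have "norm (h x - (\<Sum>i<N + 2. euler_coeff \<beta> i * x ^ i)) \<le> C * norm x ^ (N + 2)" by (rule C)
    then have "norm p * norm (h x - (\<Sum>i<N + 2. euler_coeff \<beta> i * x ^ i)) \<le> norm p * (C * norm x ^ (N + 2))"
      by (intro mult_left_mono) auto
    also have "norm p = real n powr (Re \<beta> + 1)" using n by (simp add: p_def norm_of_nat_powr)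
    also have "norm x ^ (N + 2) = real n powr (- real (N + 2))"
      unfolding nx using n by (subst powr_power) auto
    also have "real n powr (Re \<beta> + 1) * (C * real n powr (- real (N + 2))) = C * real n powr (Re \<beta> - 1 - real N)"
      by (simp add: mult.left_commute flip: powr_add) (simp add: algebra_simps)
    finally show "norm (euler_op \<beta> (\<lambda>n. of_nat n powr \<beta>) n
      - (\<Sum>j<N. euler_coeff \<beta> (j + 2) * of_nat n powr (\<beta> - 1 - of_nat j))) \<le> C * real n powr (Re \<beta> - 1 - real N)"
      unfolding L S using n by (simp add: norm_mult p_def norm_of_nat_powr flip: right_diff_distrib)
  qed
qed

lemma neg_binom_one [simp]: "neg_binom 1 n = 1"
  by (simp add: neg_binom_def flip: pochhammer_fact)

lemma neg_binom_zero: "n \<ge> 1 \<Longrightarrow> neg_binom 0 n = 0"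
  by (simp add: neg_binom_def pochhammer_0_left)

lemma dominated_by_inverse_neg_binom:
  assumes "\<gamma> \<notin> \<int>\<^sub>\<le>\<^sub>0"
  shows "dominated_by (\<lambda>n. 1 / neg_binom (\<gamma>::complex) n) (weight (1 - Re \<gamma>))"
proof -
  have "rGamma \<gamma> \<noteq> 0" using assms by (simp add: rGamma_eq_zero_iff)
  then have "(\<lambda>n. inverse (neg_binom \<gamma> n * of_nat n powr (1 - \<gamma>))) \<longlonglongrightarrow> inverse (rGamma \<gamma>)"
    by (intro tendsto_inverse neg_binom_limit)
  moreover have "inverse (neg_binom \<gamma> n * of_nat n powr (1 - \<gamma>)) = 1 / neg_binom \<gamma> n * of_nat n powr (- (1 - \<gamma>))" for n
    using powr_minus[of "of_nat n :: complex" "1 - \<gamma>"] by (simp add: field_simps)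
  ultimately show ?thesis
    using dominated_by_weightI_limit[of "\<lambda>n. 1 / neg_binom \<gamma> n" "1 - \<gamma>" "inverse (rGamma \<gamma>)"] by simp
qed

text \<open>Variation of constants for the first-order recurrence whose homogeneous solution is
  \<^term>\<open>neg_binom (\<beta> + 1)\<close>.\<close>

lemma euler_op_inversion:
  assumes \<beta>: "\<beta> + 1 \<notin> \<int>\<^sub>\<le>\<^sub>0"
    and E: "dominated_by (euler_op \<beta> f) (weight (Re \<beta> - 1 - real N))"
  obtains t where "dominated_by (\<lambda>n. f n - t * neg_binom (\<beta> + 1) n) (weight (Re \<beta> - 1 - real N))"
proof -
  define c where "c = neg_binom (\<beta> + 1)"
  have c0: "c n \<noteq> 0" for n using neg_binom_nonzero[OF \<beta>] by (simp add: c_def)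
  define q where "q n = f n / c n" for n
  \<comment> \<open>For \<open>n \<ge> 1\<close> the increments of \<open>q\<close> are
    \<open>euler_op \<beta> f n / (n * c n)\<close>, hence summable. The value at 0 makes
    \<open>q\<close> the sequence of partial sums, and the sought \<open>t\<close> is its
    limit.\<close>
  define u where "u n = (if n = 0 then q 0 else q n - q (n - 1))" for n
  have "dominated_by (\<lambda>n. 1 / of_nat n :: complex) (weight (-1))"
    by (rule dominated_by_weightI_powr[where C = 1]) (simp add: norm_divide powr_minus field_simps)
  then have "dominated_by (\<lambda>n. euler_op \<beta> f n * (1 / c n) * (1 / of_nat n))
      (\<lambda>n. weight (Re \<beta> - 1 - real N) n * weight (1 - Re (\<beta> + 1)) n * weight (-1) n)"
    unfolding c_def by (intro dominated_by_mult E dominated_by_inverse_neg_binom \<beta> weight_nonneg mult_nonneg_nonneg)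
  then have "dominated_by (\<lambda>n. euler_op \<beta> f n * (1 / c n) * (1 / of_nat n)) (weight (-2 - real N))"
    by (simp add: algebra_simps flip: weight_add)
  then have u: "dominated_by u (weight (-2 - real N))"
  proof (rule dominated_by_cong_positive)
    fix n :: nat assume "n \<ge> 1"
    then obtain m where n: "n = Suc m" by (cases n) auto
    have rec: "of_nat (Suc m) * c (Suc m) = (\<beta> + 1 + of_nat m) * c m"
      unfolding c_def by (rule neg_binom_Suc)
    have "of_nat (Suc m) * c (Suc m) * (q (Suc m) - q m)
        = of_nat (Suc m) * f (Suc m) - (of_nat (Suc m) * c (Suc m)) * (f m / c m)"
      unfolding q_def right_diff_distrib using c0[of "Suc m"] by simp
    also have "\<dots> = euler_op \<beta> f (Suc m)"
      unfolding rec euler_op_def using c0[of m] by (simp add: algebra_simps)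
    finally show "u n = euler_op \<beta> f n * (1 / c n) * (1 / of_nat n)"
      unfolding n u_def using c0[of "Suc m"] by (simp add: field_simps del: of_nat_Suc)
  qed simp
  have sm: "summable u"
    using summable_dominated_by_weight[OF u] by (auto intro: summable_norm_cancel)
  have partial: "(\<Sum>j\<le>n. u j) = q n" for n
    by (induction n) (auto simp: u_def)
  have "f n - suminf u * c n = - (c n * (\<Sum>j. u (j + Suc n)))" for n
    using suminf_split_initial_segment[OF sm, of "Suc n"] partial[of n] c0[of n]
    by (simp add: lessThan_Suc_atMost q_def field_simps)
  moreover have "dominated_by (\<lambda>n. c n * (\<Sum>j. u (j + Suc n))) (\<lambda>n. weight (Re (\<beta> + 1) - 1) n * weight ((-2 - real N) + 1) n)"
    unfolding c_def by (intro dominated_by_mult dominated_by_neg_binom summation_tail[OF u] weight_nonneg) simp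
  then have "dominated_by (\<lambda>n. c n * (\<Sum>j. u (j + Suc n))) (weight (Re \<beta> - 1 - real N))"
    by (simp add: algebra_simps flip: weight_add)
  from dominated_by_cmult[OF this, of "-1"]
  have "dominated_by (\<lambda>n. - (c n * (\<Sum>j. u (j + Suc n)))) (weight (Re \<beta> - 1 - real N))" by simp
  ultimately have "dominated_by (\<lambda>n. f n - suminf u * c n) (weight (Re \<beta> - 1 - real N))" by simp
  then show thesis using that unfolding c_def by blast
qed

section \<open>Expansion of \<open>n powr \<beta>\<close> to arbitrary order\<close>

text \<open>Summation by parts. It solves the bidiagonal system of \<open>euler_op_neg_binom\<close>
  for prescribed coefficients \<open>a\<close>.\<close>

lemma sum_partial_sums_diff:
  fixes x a :: "nat \<Rightarrow> 'a::comm_ring"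
  shows "(\<Sum>k<N. (\<Sum>i\<le>k. a i) * (x k - x (Suc k))) = (\<Sum>k<N. a k * x k) - (\<Sum>i<N. a i) * x N"
proof (induction N)
  case (Suc N)
  have "(\<Sum>i\<le>N. a i) = (\<Sum>i<N. a i) + a N" by (simp flip: lessThan_Suc_atMost)
  with Suc show ?case by (simp add: algebra_simps)
qed simp

text \<open>The image of \<open>n powr \<beta>\<close> under the operator consists of lower powers,
  which the induction hypothesis expands. The operator is then undone on the basis, and
  \<open>euler_op_inversion\<close> deals with the rest. Non-integrality passes to all lower
  exponents and keeps them away from the negative integers.\<close>

lemma powr_expandable_nonint:
  assumes "\<beta> \<notin> \<int>"
  shows "neg_binom_expandable (\<lambda>n. of_nat n powr \<beta>) \<beta> N"
  using assms
proof (induction N arbitrary: \<beta>)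
  case 0
  then show ?case by (intro expandable_dominated_by) (simp add: dominated_by_powr)
next
  case (Suc N)
  define pw where "pw n = (of_nat n :: complex) powr \<beta>" for n
  have "neg_binom_expandable (\<lambda>n. of_nat n powr (\<beta> - 1 - of_nat j)) (\<beta> - 1) N" for j
  proof -
    have "\<beta> - 1 - of_nat j \<notin> \<int>"
    proof
      assume "\<beta> - 1 - of_nat j \<in> \<int>"
      then have "(\<beta> - 1 - of_nat j) + (1 + of_nat j) \<in> \<int>" by (intro Ints_add Ints_1 Ints_of_nat)
      with Suc.prems show False by simp
    qed
    from expandable_mono[OF Suc.IH[OF this]] show ?thesis .
  qed
  then have "neg_binom_expandable (\<lambda>n. (euler_op \<beta> pw n
      - (\<Sum>j<N. euler_coeff \<beta> (j + 2) * of_nat n powr (\<beta> - 1 - of_nat j)))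
      + (\<Sum>j<N. euler_coeff \<beta> (j + 2) * of_nat n powr (\<beta> - 1 - of_nat j))) (\<beta> - 1) N"
    unfolding pw_def
    by (intro expandable_add[OF expandable_dominated_by expandable_sum] expandable_cmult)
       (use euler_op_powr[of \<beta> N] in simp_all)
  then have "neg_binom_expandable (euler_op \<beta> pw) (\<beta> - 1) N" by simp
  then obtain a where a: "dominated_by (\<lambda>n. euler_op \<beta> pw n - (\<Sum>k<N. a k * neg_binom (\<beta> - of_nat k) n)) (weight (Re \<beta> - 1 - real N))"
    unfolding neg_binom_expandable_def by auto
  \<comment> \<open>The diagonal entry at \<open>k\<close> is \<open>- Suc k\<close>. With this
    choice the images of the basis elements add up to the combination with coefficients
    \<open>a\<close>, up to a multiple of \<open>neg_binom (\<beta> - of_nat N)\<close>, which is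
    within the error.\<close>
  define d where "d k = - (\<Sum>i\<le>k. a i) / of_nat (Suc k)" for k
  define f where "f n = pw n - (\<Sum>k<N. d k * neg_binom (\<beta> - of_nat k) n)" for n
  have "dominated_by (neg_binom (\<beta> - of_nat N)) (weight (Re \<beta> - 1 - real N))"
    using dominated_by_neg_binom[of "\<beta> - of_nat N"] by (simp add: algebra_simps)
  then have "dominated_by (\<lambda>n. (euler_op \<beta> pw n - (\<Sum>k<N. a k * neg_binom (\<beta> - of_nat k) n))
      + (\<Sum>i<N. a i) * neg_binom (\<beta> - of_nat N) n) (weight (Re \<beta> - 1 - real N))"
    by (intro dominated_by_add a dominated_by_cmult)
  then have "dominated_by (euler_op \<beta> f) (weight (Re \<beta> - 1 - real N))"
  proof (rule dominated_by_cong_positive)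
    fix n :: nat assume n: "n \<ge> 1"
    have "euler_op \<beta> f n = euler_op \<beta> pw n - (\<Sum>k<N. d k * euler_op \<beta> (neg_binom (\<beta> - of_nat k)) n)"
      unfolding f_def[abs_def] euler_op_diff euler_op_sum_cmult ..
    also have "(\<Sum>k<N. d k * euler_op \<beta> (neg_binom (\<beta> - of_nat k)) n)
        = (\<Sum>k<N. (\<Sum>i\<le>k. a i) * (neg_binom (\<beta> - of_nat k) n - neg_binom (\<beta> - of_nat (Suc k)) n))"
    proof (intro sum.cong refl)
      fix k
      have "euler_op \<beta> (neg_binom (\<beta> - of_nat k)) n
          = - of_nat (Suc k) * (neg_binom (\<beta> - of_nat k) n - neg_binom (\<beta> - of_nat (Suc k)) n)"
        using euler_op_neg_binom[OF n, of \<beta> "of_nat (Suc k)"] by simp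
      then show "d k * euler_op \<beta> (neg_binom (\<beta> - of_nat k)) n
          = (\<Sum>i\<le>k. a i) * (neg_binom (\<beta> - of_nat k) n - neg_binom (\<beta> - of_nat (Suc k)) n)"
        by (simp add: d_def del: of_nat_Suc)
    qed
    finally show "euler_op \<beta> f n = (euler_op \<beta> pw n - (\<Sum>k<N. a k * neg_binom (\<beta> - of_nat k) n))
      + (\<Sum>i<N. a i) * neg_binom (\<beta> - of_nat N) n"
      unfolding sum_partial_sums_diff[of a "\<lambda>k. neg_binom (\<beta> - of_nat k) n"] by simp
  qed simp
  moreover have "\<beta> + 1 \<notin> \<int>\<^sub>\<le>\<^sub>0"
  proof
    assume "\<beta> + 1 \<in> \<int>\<^sub>\<le>\<^sub>0"
    then have "\<beta> + 1 - 1 \<in> \<int>" by (intro Ints_diff nonpos_Ints_subset_Ints[THEN subsetD] Ints_1)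
    with Suc.prems show False by simp
  qed
  \<comment> \<open>\<open>t\<close> is the leading coefficient. Its basis element is annihilated by
    the operator, so the image carries no trace of it.\<close>
  ultimately obtain t where t: "dominated_by (\<lambda>n. f n - t * neg_binom (\<beta> + 1) n) (weight (Re \<beta> - 1 - real N))"
    using euler_op_inversion by blast
  have eq: "f n - t * neg_binom (\<beta> + 1) n
      = pw n - (\<Sum>k<Suc N. (case k of 0 \<Rightarrow> t | Suc j \<Rightarrow> d j) * neg_binom (\<beta> + 1 - of_nat k) n)" for n
    unfolding f_def sum.lessThan_Suc_shift by simp
  have "dominated_by (\<lambda>n. pw n - (\<Sum>k<Suc N. (case k of 0 \<Rightarrow> t | Suc j \<Rightarrow> d j) * neg_binom (\<beta> + 1 - of_nat k) n))
      (weight (Re \<beta> - 1 - real N))"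
    by (rule dominated_by_cong[OF t]) (simp only: eq)
  moreover have "Re \<beta> - 1 - real N = Re \<beta> - real (Suc N)" by simp
  ultimately show ?case
    unfolding neg_binom_expandable_def pw_def by (intro exI) simp
qed

text \<open>Nonnegative integers are reached from below: multiplication by \<open>n\<close> raises
  the power by one and turns \<open>neg_binom \<gamma>\<close> into a multiple of
  \<open>neg_binom (\<gamma> + 1) - neg_binom \<gamma>\<close>.\<close>

lemma powr_expandable_nat:
  "neg_binom_expandable (\<lambda>n. of_nat n powr (of_nat m)) (of_nat m) N"
proof (induction m)
  case 0
  show ?case
  proof (cases N)
    case 0
    then show ?thesis
      using dominated_by_powr[of 0] by (intro expandable_dominated_by) simp
  next
    case (Suc M)
    have "dominated_by (\<lambda>n. (of_nat n :: complex) powr 0 - (\<Sum>k<N. (if k = 0 then 1 else 0) * neg_binom (0 + 1 - of_nat k) n)) (weight (Re 0 - real N))"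
    \<comment> \<open>At \<open>n = 0\<close> the difference is -1, since
      \<open>0 powr 0 = 0\<close> but \<open>neg_binom 1 0 = 1\<close>.\<close>
    proof (rule dominated_by_cong_positive[OF dominated_by_zero])
      fix n :: nat assume "n \<ge> 1"
      then show "(of_nat n :: complex) powr 0 - (\<Sum>k<N. (if k = 0 then 1 else 0) * neg_binom (0 + 1 - of_nat k) n) = 0"
        unfolding Suc sum.lessThan_Suc_shift by simp
    qed auto
    then show ?thesis unfolding neg_binom_expandable_def by auto
  qed
next
  case (Suc m)
  define \<beta> where "\<beta> = (of_nat m :: complex)"
  obtain a where a: "dominated_by (\<lambda>n. of_nat n powr \<beta> - (\<Sum>k<N. a k * neg_binom (\<beta> + 1 - of_nat k) n)) (weight (Re \<beta> - real N))"
    using Suc unfolding neg_binom_expandable_def \<beta>_def by blast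
  define R where "R n = of_nat n powr \<beta> - (\<Sum>k<N. a k * neg_binom (\<beta> + 1 - of_nat k) n)" for n
  have nR: "dominated_by (\<lambda>n. of_nat n * R n) (weight (Re (\<beta> + 1) - real N))"
  proof -
    have "dominated_by (\<lambda>n. of_nat n :: complex) (weight 1)"
      by (rule dominated_by_weightI_powr[where C = 1]) simp
    from dominated_by_mult[OF this a] show ?thesis
      by (simp add: R_def algebra_simps flip: weight_add)
  qed
  have nb: "of_nat n * neg_binom \<gamma> n = \<gamma> * (neg_binom (\<gamma> + 1) n - neg_binom \<gamma> n)" for n and \<gamma> :: complex
  proof (cases n)
    case (Suc k)
    have "of_nat (Suc k) * neg_binom \<gamma> (Suc k) = \<gamma> * neg_binom (\<gamma> + 1) k"
      using neg_binom_minus_one[of k "\<gamma> + 1"] by simp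
    moreover have "neg_binom (\<gamma> + 1) k = neg_binom (\<gamma> + 1) (Suc k) - neg_binom \<gamma> (Suc k)"
      using neg_binom_diff[of "\<gamma> + 1" k] by (simp add: algebra_simps)
    ultimately show ?thesis using Suc by simp
  qed simp
  define A where "A k = a k * (\<beta> + 1 - of_nat k)" for k
  have "neg_binom_expandable (\<lambda>n. (\<Sum>k<N. A k * neg_binom (\<beta> + 1 + 1 - of_nat k) n)
      + (-1) * (\<Sum>k<N. A k * neg_binom (\<beta> + 1 - of_nat k) n) + of_nat n * R n) (\<beta> + 1) N"
    by (rule expandable_add[OF expandable_add[OF expandable_basis
            expandable_cmult[OF expandable_drop[OF expandable_shift]]] expandable_dominated_by[OF nR]])
       (simp add: expandable_basis)
  moreover have "(\<Sum>k<N. A k * neg_binom (\<beta> + 1 + 1 - of_nat k) n)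
      + (-1) * (\<Sum>k<N. A k * neg_binom (\<beta> + 1 - of_nat k) n) + of_nat n * R n = of_nat n powr (\<beta> + 1)" for n
  proof -
    have "of_nat n powr (\<beta> + 1) = of_nat n * of_nat n powr \<beta>"
      by (cases "n = 0") (simp_all add: powr_add)
    also have "\<dots> = of_nat n * (\<Sum>k<N. a k * neg_binom (\<beta> + 1 - of_nat k) n) + of_nat n * R n"
      by (simp add: R_def algebra_simps)
    also have "of_nat n * (\<Sum>k<N. a k * neg_binom (\<beta> + 1 - of_nat k) n)
        = (\<Sum>k<N. a k * (of_nat n * neg_binom (\<beta> + 1 - of_nat k) n))"
      by (simp add: sum_distrib_left mult_ac)
    also have "\<dots> = (\<Sum>k<N. A k * neg_binom (\<beta> + 1 + 1 - of_nat k) n - A k * neg_binom (\<beta> + 1 - of_nat k) n)"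
      unfolding nb A_def by (intro sum.cong refl) (simp add: algebra_simps)
    finally show ?thesis by (simp add: sum_subtractf)
  qed
  ultimately show ?case by (simp add: \<beta>_def add.commute)
qed

lemma powr_expandable:
  assumes "\<beta> + 1 \<notin> \<int>\<^sub>\<le>\<^sub>0"
  shows "neg_binom_expandable (\<lambda>n. of_nat n powr \<beta>) \<beta> N"
proof (cases "\<beta> \<in> \<int>")
  case True
  then obtain i where i: "\<beta> = of_int i" by (elim Ints_cases)
  have "i \<ge> 0"
  proof (rule ccontr)
    assume "\<not> i \<ge> 0"
    then have "of_int (i + 1) \<in> (\<int>\<^sub>\<le>\<^sub>0 :: complex set)" by (subst of_int_in_nonpos_Ints_iff) simp
    with assms i show False by simp
  qed
  then have "\<beta> = of_nat (nat i)" using i by simp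
  then show ?thesis using powr_expandable_nat by metis
qed (rule powr_expandable_nonint)

text \<open>Comparing limits after division by \<open>n powr \<beta>\<close> gives
  \<open>a 0\<close>. The operator then removes the leading term, and the same comparison one order
  lower gives \<open>a 1\<close>. \<open>N \<ge> 3\<close> keeps the image of the remainder at order
  \<open>Re \<beta> - 2\<close>.\<close>

lemma powr_neg_binom_expansion:
  assumes \<beta>: "\<beta> + 1 \<notin> \<int>\<^sub>\<le>\<^sub>0" and N: "N \<ge> 3"
  obtains a where "a 0 = Gamma (\<beta> + 1)" "a 1 = - Gamma (\<beta> + 1) * (\<beta> + 1) / 2"
    "dominated_by (\<lambda>n. of_nat n powr \<beta> - (\<Sum>k<N. a k * neg_binom (\<beta> + 1 - of_nat k) n)) (weight (Re \<beta> - real N))"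
proof (cases "\<beta> = 0")
  case True
  \<comment> \<open>For \<beta> = 0 the coefficient \<open>a 1\<close> belongs to
    \<open>neg_binom 0\<close>, which vanishes for \<open>n \<ge> 1\<close>; it is arbitrary and set
    to what the general formula gives.\<close>
  define a where "a k = (if k = 0 then 1 else if k = 1 then -1/2 else (0::complex))" for k :: nat
  obtain M where M: "N = Suc (Suc M)" using N by (intro that[of "N - 2"]) simp
  have "dominated_by (\<lambda>n. (of_nat n :: complex) powr \<beta> - (\<Sum>k<N. a k * neg_binom (\<beta> + 1 - of_nat k) n)) (weight (Re \<beta> - real N))"
  proof (rule dominated_by_cong_positive[OF dominated_by_zero])
    fix n :: nat assume "n \<ge> 1"
    then show "(of_nat n :: complex) powr \<beta> - (\<Sum>k<N. a k * neg_binom (\<beta> + 1 - of_nat k) n) = 0"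
      unfolding True M sum.lessThan_Suc_shift
      by (simp add: a_def neg_binom_zero)
  qed auto
  then show thesis using that[of a] True by (simp add: a_def)
next
  case False
  obtain a where a: "dominated_by (\<lambda>n. of_nat n powr \<beta> - (\<Sum>k<N. a k * neg_binom (\<beta> + 1 - of_nat k) n)) (weight (Re \<beta> - real N))"
    using powr_expandable[OF \<beta>] unfolding neg_binom_expandable_def by blast
  define D where "D n = of_nat n powr \<beta> - (\<Sum>k<N. a k * neg_binom (\<beta> + 1 - of_nat k) n)" for n
  have D: "dominated_by D (weight (Re \<beta> - real N))" using a by (simp add: D_def[abs_def])
  obtain M where M: "N = Suc (Suc M)" using N by (intro that[of "N - 2"]) simp
  have rG: "rGamma (\<beta> + 1) \<noteq> 0" using \<beta> by (simp add: rGamma_eq_zero_iff)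
  have a0: "a 0 = Gamma (\<beta> + 1)"
  proof -
    define R where "R n = (\<Sum>k<Suc M. a (Suc k) * neg_binom (\<beta> - of_nat k) n) + D n" for n
    have "dominated_by R (weight (Re \<beta> - 1))"
      unfolding R_def
    proof (intro dominated_by_add dominated_by_sum dominated_by_cmult weight_nonneg)
      fix k
      show "dominated_by (neg_binom (\<beta> - of_nat k)) (weight (Re \<beta> - 1))"
        by (rule dominated_by_weight_mono[OF dominated_by_neg_binom]) simp
    next
      show "dominated_by D (weight (Re \<beta> - 1))"
        by (rule dominated_by_weight_mono[OF D]) (use N in simp)
    qed
    then have "(\<lambda>n. R n * of_nat n powr (-\<beta>)) \<longlonglongrightarrow> 0"
      by (rule dominated_by_imp_limit_zero) simp
    moreover have "(\<lambda>n. a 0 * (neg_binom (\<beta> + 1) n * of_nat n powr (1 - (\<beta> + 1)))) \<longlonglongrightarrow> a 0 * rGamma (\<beta> + 1)"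
      by (intro tendsto_mult_left neg_binom_limit)
    ultimately have "(\<lambda>n. a 0 * (neg_binom (\<beta> + 1) n * of_nat n powr (1 - (\<beta> + 1))) + R n * of_nat n powr (-\<beta>)) \<longlonglongrightarrow> a 0 * rGamma (\<beta> + 1) + 0"
      by (rule tendsto_add[rotated])
    moreover have "a 0 * (neg_binom (\<beta> + 1) n * of_nat n powr (1 - (\<beta> + 1))) + R n * of_nat n powr (-\<beta>) = 1" if "n > 0" for n
    proof -
      have "of_nat n powr \<beta> = a 0 * neg_binom (\<beta> + 1) n + R n"
        unfolding R_def D_def M sum.lessThan_Suc_shift by (simp add: diff_diff_eq add.commute)
      then have "(a 0 * neg_binom (\<beta> + 1) n + R n) * of_nat n powr (-\<beta>) = of_nat n powr \<beta> * of_nat n powr (-\<beta>)"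
        by simp
      also have "\<dots> = 1" using that by (simp flip: powr_add)
      finally show ?thesis by (simp add: ring_distribs mult.assoc)
    qed
    then have "(\<lambda>n. a 0 * (neg_binom (\<beta> + 1) n * of_nat n powr (1 - (\<beta> + 1))) + R n * of_nat n powr (-\<beta>)) \<longlonglongrightarrow> 1"
      by (intro tendsto_eventually eventually_mono[OF eventually_gt_at_top[of 0]])
    ultimately have "a 0 * rGamma (\<beta> + 1) + 0 = 1" by (rule LIMSEQ_unique)
    then show ?thesis using rG by (simp add: Gamma_def field_simps)
  qed
  have a1: "a 1 = - Gamma (\<beta> + 1) * (\<beta> + 1) / 2"
  proof -
    define \<gamma> where "\<gamma> = \<beta> - 1"
    define pw where "pw n = (of_nat n :: complex) powr \<beta>" for n
    define Q where "Q n = euler_op \<beta> pw n - euler_coeff \<beta> 2 * of_nat n powr \<gamma>" for n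
    \<comment> \<open>Collects everything of order \<open>Re \<beta> - 2\<close>. Left outside are
      \<open>a 1 * neg_binom \<beta> n\<close> and
      \<open>euler_coeff \<beta> 2 * n powr (\<beta> - 1)\<close>, whose limits are
      compared.\<close>
    define R where "R n = euler_op \<beta> D n + (\<Sum>k<M. a (Suc (Suc k)) * euler_op \<beta> (neg_binom (\<beta> + 1 - of_nat (Suc (Suc k)))) n)
      + a 1 * neg_binom (\<beta> - 1) n - Q n" for n
    have "dominated_by R (weight (Re \<beta> - 2))"
      unfolding R_def
    proof (intro dominated_by_diff dominated_by_add dominated_by_sum dominated_by_cmult weight_nonneg)
      show "dominated_by (euler_op \<beta> D) (weight (Re \<beta> - 2))"
        by (rule dominated_by_weight_mono[OF dominated_by_euler_op[OF D]]) (use N in simp)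
      show "dominated_by Q (weight (Re \<beta> - 2))"
        using euler_op_powr[of \<beta> 1] by (simp add: Q_def[abs_def] pw_def[abs_def] \<gamma>_def numeral_2_eq_2)
      show "dominated_by (neg_binom (\<beta> - 1)) (weight (Re \<beta> - 2))"
        by (rule dominated_by_weight_mono[OF dominated_by_neg_binom]) simp
      fix k
      have 1: "dominated_by (neg_binom (\<beta> + 1 - of_nat (Suc (Suc k)))) (weight (Re \<beta> - 2))"
        by (rule dominated_by_weight_mono[OF dominated_by_neg_binom]) simp
      have 2: "dominated_by (neg_binom (\<beta> - of_nat (Suc (Suc k)))) (weight (Re \<beta> - 2))"
        by (rule dominated_by_weight_mono[OF dominated_by_neg_binom]) simp
      show "dominated_by (euler_op \<beta> (neg_binom (\<beta> + 1 - of_nat (Suc (Suc k))))) (weight (Re \<beta> - 2))"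
        by (rule dominated_by_cong_positive[OF dominated_by_cmult[OF dominated_by_diff[OF 1 2]] weight_pos])
          (rule euler_op_neg_binom)
    qed
    then have "(\<lambda>n. R n * of_nat n powr (-\<gamma>)) \<longlonglongrightarrow> 0"
      by (rule dominated_by_imp_limit_zero) (simp add: \<gamma>_def)
    moreover have "(\<lambda>n. - a 1 * (neg_binom \<beta> n * of_nat n powr (1 - \<beta>))) \<longlonglongrightarrow> - a 1 * rGamma \<beta>"
      by (intro tendsto_mult_left neg_binom_limit)
    ultimately have "(\<lambda>n. - a 1 * (neg_binom \<beta> n * of_nat n powr (1 - \<beta>)) + R n * of_nat n powr (-\<gamma>)) \<longlonglongrightarrow> - a 1 * rGamma \<beta> + 0"
      by (rule tendsto_add[rotated])
    moreover have "- a 1 * (neg_binom \<beta> n * of_nat n powr (1 - \<beta>)) + R n * of_nat n powr (-\<gamma>) = euler_coeff \<beta> 2" if n: "n > 0" for n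
    proof -
      have n1: "n \<ge> 1" using n by simp
      have "euler_op \<beta> D n = euler_op \<beta> pw n - (\<Sum>k<N. a k * euler_op \<beta> (neg_binom (\<beta> + 1 - of_nat k)) n)"
        unfolding D_def[abs_def] pw_def[abs_def] euler_op_diff euler_op_sum_cmult ..
      also have "(\<Sum>k<N. a k * euler_op \<beta> (neg_binom (\<beta> + 1 - of_nat k)) n)
          = - a 1 * (neg_binom \<beta> n - neg_binom (\<beta> - 1) n)
            + (\<Sum>k<M. a (Suc (Suc k)) * euler_op \<beta> (neg_binom (\<beta> + 1 - of_nat (Suc (Suc k)))) n)"
        using euler_op_neg_binom[OF n1, of \<beta> 0] euler_op_neg_binom[OF n1, of \<beta> 1]
        unfolding M sum.lessThan_Suc_shift by (simp add: right_diff_distrib)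
      finally have "R n = euler_coeff \<beta> 2 * of_nat n powr \<gamma> + a 1 * neg_binom \<beta> n"
        by (simp add: R_def Q_def algebra_simps)
      moreover have "of_nat n powr \<gamma> * of_nat n powr (-\<gamma>) = (1 :: complex)" using n by (simp flip: powr_add)
      moreover have "1 - \<beta> = - \<gamma>" by (simp add: \<gamma>_def)
      ultimately show ?thesis by (simp add: ring_distribs mult.assoc)
    qed
    then have "(\<lambda>n. - a 1 * (neg_binom \<beta> n * of_nat n powr (1 - \<beta>)) + R n * of_nat n powr (-\<gamma>)) \<longlonglongrightarrow> euler_coeff \<beta> 2"
      by (intro tendsto_eventually eventually_mono[OF eventually_gt_at_top[of 0]])
    ultimately have "- a 1 * rGamma \<beta> + 0 = euler_coeff \<beta> 2" by (rule LIMSEQ_unique)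
    \<comment> \<open>Both sides contain a factor \<beta>; cancelling it is what forces the separate
      case \<beta> = 0.\<close>
    moreover have "rGamma \<beta> = \<beta> * rGamma (\<beta> + 1)" by (simp add: rGamma_plus1)
    ultimately have "\<beta> * (- a 1 * rGamma (\<beta> + 1)) = \<beta> * ((\<beta> + 1) / 2)" by (simp add: euler_coeff_values mult_ac)
    then have "- a 1 * rGamma (\<beta> + 1) = (\<beta> + 1) / 2" using False by (simp only: mult_cancel_left) simp
    then have "- a 1 * rGamma (\<beta> + 1) / rGamma (\<beta> + 1) = (\<beta> + 1) / 2 / rGamma (\<beta> + 1)"
      by (rule arg_cong)
    then have "- a 1 = (\<beta> + 1) / 2 / rGamma (\<beta> + 1)" using rG by simp
    then have "- (- a 1) = - ((\<beta> + 1) / 2 / rGamma (\<beta> + 1))" by (rule arg_cong)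
    then have *: "a 1 = - ((\<beta> + 1) / 2 / rGamma (\<beta> + 1))" by simp
    have "Gamma (\<beta> + 1) = 1 / rGamma (\<beta> + 1)" by (simp add: Gamma_def field_simps)
    then show ?thesis unfolding * by simp
  qed
  show thesis using that[OF a0 a1 a] .
qed

section \<open>Fractional integrals of powers\<close>

text \<open>The integrand of the fractional integral of \<open>s powr b\<close> at the point 1,
  without the Gamma factor. Other points follow by scaling.\<close>

definition beta_kernel :: "real \<Rightarrow> complex \<Rightarrow> real \<Rightarrow> complex" where
  "beta_kernel a b s = of_real ((1 - s) powr (a - 1)) * of_real s powr b"

lemma norm_beta_kernel: "s \<ge> 0 \<Longrightarrow> norm (beta_kernel a b s) = (1 - s) powr (a - 1) * s powr Re b"
  by (simp add: beta_kernel_def norm_mult norm_powr_real_powr)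

lemma beta_kernel_eq_exp:
  "s > 0 \<Longrightarrow> beta_kernel a b s = of_real ((1 - s) powr (a - 1)) * exp (b * of_real (ln s))"
  by (simp add: beta_kernel_def powr_def Ln_of_real)

lemma real_beta_kernel_integrable:
  assumes "a > 0" "c > -1"
  shows "(\<lambda>s. (1 - s) powr (a - 1) * s powr c) integrable_on {0..1::real}"
  using integrable_Beta'[of "c + 1" a] assms by (simp add: mult.commute)

lemma beta_kernel_integrable:
  assumes "a > 0" "Re b > -1"
  shows "beta_kernel a b integrable_on {0..1}"
proof -
  have "beta_kernel a b absolutely_integrable_on {0<..<1}"
  proof (rule measurable_bounded_by_integrable_imp_absolutely_integrable)
    have "continuous_on {0<..<1} (\<lambda>s. of_real ((1 - s) powr (a - 1)) * exp (b * of_real (ln s)) :: complex)"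
      by (intro continuous_intros) auto
    then have "continuous_on {0<..<1} (beta_kernel a b)"
      by (rule continuous_on_eq) (simp add: beta_kernel_eq_exp)
    then show "beta_kernel a b \<in> borel_measurable (lebesgue_on {0<..<1})"
      by (rule continuous_imp_measurable_on_sets_lebesgue) auto
    show "(\<lambda>s. (1 - s) powr (a - 1) * s powr Re b) integrable_on {0<..<1::real}"
      using real_beta_kernel_integrable[OF assms] by (simp add: integrable_on_Icc_iff_Ioo)
  qed (auto simp: norm_beta_kernel)
  then show ?thesis
    unfolding integrable_on_Icc_iff_Ioo by (rule set_lebesgue_integral_eq_integral(1))
qed

text \<open>Away from both endpoints the integrand is continuous in \<open>s\<close> and entire in
  \<open>b\<close>, so differentiation under the integral sign applies.\<close>

lemma beta_kernel_integral_holomorphic_inner: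
  assumes "0 < u" "v < 1"
  shows "(\<lambda>b. integral {u..v} (beta_kernel a b)) holomorphic_on UNIV"
proof -
  have *: "beta_kernel a b s = of_real ((1 - s) powr (a - 1)) * exp (b * of_real (ln s))" if "s \<in> cbox u v" for b s
    using that assms by (simp add: beta_kernel_eq_exp)
  have "(\<lambda>b. integral (cbox u v) (beta_kernel a b)) holomorphic_on UNIV"
  proof (rule leibniz_rule_holomorphic)
    fix b :: complex and s assume s: "s \<in> cbox u v"
    have "((\<lambda>b. of_real ((1 - s) powr (a - 1)) * exp (b * of_real (ln s))) has_field_derivative
        of_real ((1 - s) powr (a - 1)) * (exp (b * of_real (ln s)) * of_real (ln s))) (at b within UNIV)"
      by (auto intro!: derivative_eq_intros)
    then show "((\<lambda>b. beta_kernel a b s) has_field_derivative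
        of_real ((1 - s) powr (a - 1)) * (exp (b * of_real (ln s)) * of_real (ln s))) (at b within UNIV)"
      by (simp only: *[OF s])
  next
    fix b :: complex
    have "continuous_on (cbox u v) (\<lambda>s. of_real ((1 - s) powr (a - 1)) * exp (b * of_real (ln s)) :: complex)"
      using assms by (intro continuous_intros) auto
    then have "continuous_on (cbox u v) (beta_kernel a b)"
      by (rule continuous_on_eq) (simp only: *)
    then show "beta_kernel a b integrable_on cbox u v" by (rule integrable_continuous)
  next
    show "continuous_on (UNIV \<times> cbox u v)
      (\<lambda>(b, s). of_real ((1 - s) powr (a - 1)) * (exp (b * of_real (ln s)) * of_real (ln s)) :: complex)"
      unfolding case_prod_unfold using assms by (intro continuous_intros) auto
  qed auto
  then show ?thesis by simp
qed

text \<open>A locally uniform limit of truncated integrals. On a disc where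
  \<open>Re b \<ge> c\<close> one real majorant \<open>G\<close> serves all \<open>b\<close>, and
  the truncation error is bounded by increments of its continuous primitive \<open>H\<close> near
  the endpoints.\<close>

lemma beta_kernel_integral_holomorphic:
  assumes a: "a > 0"
  shows "(\<lambda>b. integral {0..1} (beta_kernel a b)) holomorphic_on {b. Re b > -1}"
proof (rule holomorphic_uniform_sequence)
  define u where "u k = 1 / real (k + 3)" for k
  define v where "v k = 1 - 1 / real (k + 3)" for k
  have uv: "0 < u k" "u k \<le> v k" "v k < 1" for k by (auto simp: u_def v_def field_simps)
  show "open {b. Re b > -1}" by (rule open_halfspace_Re_gt)
  show "(\<lambda>b. integral {u k..v k} (beta_kernel a b)) holomorphic_on {b. Re b > -1}" for k
    by (rule holomorphic_on_subset[OF beta_kernel_integral_holomorphic_inner]) (use uv in auto)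
  fix x assume x: "x \<in> {b. Re b > -1}"
  \<comment> \<open>Half the distance to the line \<open>Re b = -1\<close>; \<open>c\<close> is the
    least real part on the closed disc of radius \<open>d\<close>.\<close>
  define d where "d = (Re x + 1) / 2"
  define c where "c = Re x - d"
  have d: "d > 0" and c: "c > -1" using x by (auto simp: d_def c_def field_simps)
  have Re_ge: "Re b \<ge> c" if "b \<in> cball x d" for b
    using abs_Re_le_cmod[of "x - b"] that by (auto simp: c_def dist_norm)
  define G where "G s = (1 - s) powr (a - 1) * s powr c" for s :: real
  have G: "G integrable_on {0..1}" using real_beta_kernel_integrable[OF a c] by (simp add: G_def[abs_def])
  have G': "G integrable_on {p..q}" if "0 \<le> p" "q \<le> 1" for p q
    by (rule integrable_on_subinterval[OF G]) (use that in auto)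
  define H where "H y = integral {0..y} G" for y
  have bound: "norm (integral {0..1} (beta_kernel a b) - integral {u k..v k} (beta_kernel a b)) \<le> H (u k) + (H 1 - H (v k))"
    if b: "b \<in> cball x d" for b k
  proof -
    have Kb: "beta_kernel a b integrable_on {0..1}"
      using beta_kernel_integrable[OF a] Re_ge[OF b] c by simp
    have K': "beta_kernel a b integrable_on {p..q}" if "0 \<le> p" "q \<le> 1" for p q
      by (rule integrable_on_subinterval[OF Kb]) (use that in auto)
    have nb: "norm (integral {p..q} (beta_kernel a b)) \<le> integral {p..q} G" if "0 \<le> p" "q \<le> 1" for p q
    proof (rule integral_norm_bound_integral[OF K' G'])
      fix s assume s: "s \<in> {p..q}"
      have "s powr Re b \<le> s powr c"
      proof (cases "s = 0")
        case False
        then show ?thesis using s that Re_ge[OF b] by (intro powr_mono') auto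
      qed simp
      then show "norm (beta_kernel a b s) \<le> G s"
        using s that by (simp add: norm_beta_kernel G_def mult_left_mono)
    qed (use that in auto)
    have "integral {0..1} (beta_kernel a b) = integral {0..v k} (beta_kernel a b) + integral {v k..1} (beta_kernel a b)"
      using uv[of k] by (intro Henstock_Kurzweil_Integration.integral_combine[symmetric] Kb) auto
    also have "integral {0..v k} (beta_kernel a b) = integral {0..u k} (beta_kernel a b) + integral {u k..v k} (beta_kernel a b)"
      using uv[of k] by (intro Henstock_Kurzweil_Integration.integral_combine[symmetric] K') auto
    finally have "norm (integral {0..1} (beta_kernel a b) - integral {u k..v k} (beta_kernel a b))
        = norm (integral {0..u k} (beta_kernel a b) + integral {v k..1} (beta_kernel a b))" by simp
    also have "\<dots> \<le> integral {0..u k} G + integral {v k..1} G"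
      using uv[of k] by (intro norm_triangle_mono nb) auto
    also have "integral {v k..1} G = H 1 - H (v k)"
      using Henstock_Kurzweil_Integration.integral_combine[of 0 "v k" 1 G] uv[of k] G by (simp add: H_def)
    finally show ?thesis by (simp add: H_def)
  qed
  have contH: "continuous_on {0..1} H"
    unfolding H_def by (rule indefinite_integral_continuous_1[OF G])
  have "(\<lambda>k. H (u k)) \<longlonglongrightarrow> H 0"
    by (rule continuous_on_tendsto_compose[OF contH]) (use uv in \<open>auto simp: u_def intro!: always_eventually\<close>, real_asymp)
  moreover have "(\<lambda>k. H (v k)) \<longlonglongrightarrow> H 1"
    by (rule continuous_on_tendsto_compose[OF contH]) (use uv in \<open>auto simp: v_def intro!: always_eventually\<close>, real_asymp)
  ultimately have "(\<lambda>k. H (u k) + (H 1 - H (v k))) \<longlonglongrightarrow> H 0 + (H 1 - H 1)"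
    by (intro tendsto_intros)
  then have lim: "(\<lambda>k. H (u k) + (H 1 - H (v k))) \<longlonglongrightarrow> 0" by (simp add: H_def)
  have "uniform_limit (cball x d) (\<lambda>k b. integral {u k..v k} (beta_kernel a b)) (\<lambda>b. integral {0..1} (beta_kernel a b)) sequentially"
  proof (rule uniform_limitI)
    fix e :: real assume "e > 0"
    then have "\<forall>\<^sub>F k in sequentially. H (u k) + (H 1 - H (v k)) < e"
      using order_tendstoD(2)[OF lim] by blast
    then show "\<forall>\<^sub>F k in sequentially. \<forall>b\<in>cball x d. dist (integral {u k..v k} (beta_kernel a b)) (integral {0..1} (beta_kernel a b)) < e"
      by eventually_elim (auto simp: dist_norm norm_minus_commute intro: le_less_trans[OF bound])
  qed
  moreover have "cball x d \<subseteq> {b. Re b > -1}" using Re_ge c by force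
  ultimately show "\<exists>d>0. cball x d \<subseteq> {b. Re b > -1} \<and>
      uniform_limit (cball x d) (\<lambda>k b. integral {u k..v k} (beta_kernel a b)) (\<lambda>b. integral {0..1} (beta_kernel a b)) sequentially"
    using d by blast
qed

lemma plus_one_nonpos_Int_Re: "z + 1 \<in> \<int>\<^sub>\<le>\<^sub>0 \<Longrightarrow> Re z \<le> -1"
  by (auto elim!: nonpos_Ints_cases simp: complex_eq_iff)

text \<open>For real \<open>b\<close> this is the real Beta integral. Both sides are holomorphic in
  the half-plane, and the real points accumulate at 0, so the identity theorem extends it to complex
  \<open>b\<close>.\<close>

lemma beta_kernel_has_integral:
  assumes a: "a > 0" and b: "Re b > -1"
  shows "(beta_kernel a b has_integral (Gamma (of_real a) * Gamma (b + 1) * rGamma (of_real a + b + 1))) {0..1}"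
proof -
  define S where "S = {b. Re b > -1}"
  define F where "F b = integral {0..1} (beta_kernel a b) - Gamma (of_real a) * Gamma (b + 1) * rGamma (of_real a + b + 1)" for b
  define U where "U = complex_of_real ` {-1<..}"
  have "F b = 0"
  proof (rule analytic_continuation[of F S U 0])
    have "(\<lambda>b. Gamma (b + 1)) holomorphic_on S"
      by (rule holomorphic_Gamma') (auto intro!: holomorphic_intros simp: S_def dest!: plus_one_nonpos_Int_Re)
    then show "F holomorphic_on S"
      unfolding F_def using beta_kernel_integral_holomorphic[OF a]
      by (intro holomorphic_intros) (auto simp: S_def dest: plus_one_nonpos_Int_Re)
    show "open S" unfolding S_def by (rule open_halfspace_Re_gt)
    show "connected S" unfolding S_def by (intro convex_connected convex_halfspace_Re_gt)
    show "U \<subseteq> S" by (auto simp: U_def S_def)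
    show "0 \<in> S" "b \<in> S" using b by (auto simp: S_def)
    show "0 islimpt U"
      unfolding islimpt_approachable
    proof (intro allI impI)
      fix e :: real assume "e > 0"
      then show "\<exists>x'\<in>U. x' \<noteq> 0 \<and> dist x' 0 < e"
        by (intro bexI[of _ "of_real (e / 2)"]) (auto simp: U_def simp del: of_real_divide)
    qed
    fix z assume "z \<in> U"
    then obtain t where z: "z = of_real t" and t: "t > -1" by (auto simp: U_def)
    have "((\<lambda>s. s powr (t + 1 - 1) * (1 - s) powr (a - 1)) has_integral Beta (t + 1) a) {0..1}"
      using has_integral_Beta_real[of "t + 1" a] t a by simp
    then have "((\<lambda>s. complex_of_real (s powr t * (1 - s) powr (a - 1))) has_integral of_real (Beta (t + 1) a)) {0..1}"
      by (intro has_integral_of_real) simp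
    then have "(beta_kernel a z has_integral of_real (Beta (t + 1) a)) {0..1}"
      by (rule has_integral_eq[rotated]) (simp add: beta_kernel_def z powr_of_real)
    then have "integral {0..1} (beta_kernel a z) = Beta (of_real (t + 1)) (of_real a)"
      by (simp add: integral_unique flip: Beta_complex_of_real)
    then show "F z = 0"
      by (simp add: F_def Beta_altdef z algebra_simps)
  qed
  then show ?thesis
    using beta_kernel_integrable[OF a b] by (simp add: F_def has_integral_iff)
qed

lemma frac_integral_power:
  assumes a: "a \<ge> 0" and b: "Re b > -1" and x: "x > 0"
  shows "frac_integral a (power_fun b) x = Gamma (b + 1) * rGamma (of_real a + b + 1) * of_real x powr (of_real a + b)"
proof (cases "a = 0")
  case True
  have "Gamma (b + 1) \<noteq> 0" using b plus_one_nonpos_Int_Re[of b] by (auto simp: Gamma_eq_zero_iff)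
  then have "Gamma (b + 1) * rGamma (b + 1) = 1" by (simp add: rGamma_inverse_Gamma)
  then show ?thesis using True x by (simp add: frac_integral_def power_fun_def)
next
  case False
  then have a: "a > 0" using a by simp
  define I where "I = Gamma (of_real a) * Gamma (b + 1) * rGamma (of_real a + b + 1)"
  define P where "P = of_real (x powr (a - 1)) * of_real x powr b"
  have "((\<lambda>s. beta_kernel a b (s / x)) has_integral (x *\<^sub>R I)) {0..x}"
    using has_integral_affinity[of "beta_kernel a b" I 0 1 "1 / x" 0] beta_kernel_has_integral[OF a b] x
    by (simp add: I_def image_mult_atLeastAtMost_if)
  then have "((\<lambda>s. P * beta_kernel a b (s / x)) has_integral (P * (x *\<^sub>R I))) {0..x}"
    by (rule has_integral_mult_right)
  then have "((\<lambda>s. ((x - s) powr (a - 1)) *\<^sub>R power_fun b s) has_integral (P * (x *\<^sub>R I))) {0..x}"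
  \<comment> \<open>The point 0 is left out since \<open>power_fun\<close> and \<open>powr\<close>
    disagree there when \<open>b = 0\<close>.\<close>
  proof (rule has_integral_spike_finite[of "{0}", rotated 2])
    fix s assume s: "s \<in> {0..x} - {0}"
    have "(x - s) powr (a - 1) = x powr (a - 1) * (1 - s / x) powr (a - 1)"
    proof -
      have "x - s = x * (1 - s / x)" using x by (simp add: field_simps)
      then have "(x - s) powr (a - 1) = (x * (1 - s / x)) powr (a - 1)" by (simp only:)
      then show ?thesis by (simp only: powr_mult)
    qed
    moreover have "of_real s powr b = of_real x powr b * of_real (s / x) powr b"
      using powr_times_real[of "of_real x" "of_real (s / x)" b] s x by simp
    moreover have "power_fun b s = of_real s powr b"
      using s by (simp add: power_fun_def)
    ultimately show "((x - s) powr (a - 1)) *\<^sub>R power_fun b s = P * beta_kernel a b (s / x)"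
      by (simp add: P_def beta_kernel_def scaleR_conv_of_real mult_ac)
  qed simp
  then have "integral {0..x} (\<lambda>s. ((x - s) powr (a - 1)) *\<^sub>R power_fun b s) = P * (x *\<^sub>R I)"
    by (rule integral_unique)
  then have "frac_integral a (power_fun b) x = of_real (1 / Gamma a) * (P * of_real x * I)"
    using False by (simp add: frac_integral_def scaleR_conv_of_real)
  moreover have "of_real (1 / Gamma a) * Gamma (of_real a) = (1 :: complex)"
    using less_imp_neq[OF Gamma_real_pos[OF a]] by (simp add: Gamma_complex_of_real flip: of_real_mult)
  moreover have "P * of_real x = of_real x powr (of_real a + b)"
  proof -
    have "P = of_real x powr (of_real a - 1) * of_real x powr b"
      unfolding P_def using x by (simp flip: powr_of_real)
    then show ?thesis using x by (simp add: powr_add powr_diff)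
  qed
  ultimately show ?thesis by (simp add: I_def mult.assoc)
qed

section \<open>Negative orders and analytic continuation in the exponent\<close>

text \<open>Each derivative contributes a factor \<open>e\<close>, absorbed by
  \<open>e * rGamma (e + 1) = rGamma e\<close>; no exception arises when a derivative vanishes. The
  formula for \<open>f\<close> is known only for positive \<open>x\<close>, so differentiation is
  local to that open set.\<close>

lemma iterated_derivative_power:
  fixes f :: "real \<Rightarrow> complex"
  assumes "\<And>x. x > 0 \<Longrightarrow> f x = C * rGamma (c + 1) * of_real x powr c" "x > 0"
  shows "((\<lambda>f x. vector_derivative f (at x)) ^^ n) f x = C * rGamma (c + 1 - of_nat n) * of_real x powr (c - of_nat n)"
  using assms(2)
proof (induction n arbitrary: x)
  case (Suc n)
  define g where "g = ((\<lambda>f x. vector_derivative f (at x)) ^^ n) f"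
  define e where "e = c - of_nat n"
  have g: "g y = C * rGamma (e + 1) * of_real y powr e" if "y > 0" for y
    using Suc.IH[OF that] by (simp add: g_def e_def algebra_simps)
  have "((\<lambda>z. C * rGamma (e + 1) * z powr e) has_field_derivative
      C * rGamma (e + 1) * (e * of_real x powr (e - 1))) (at (of_real x))"
    using Suc.prems by (intro DERIV_cmult has_field_derivative_powr) (simp add: complex_nonpos_Reals_iff)
  then have "((\<lambda>y. C * rGamma (e + 1) * of_real y powr e) has_vector_derivative
      C * rGamma (e + 1) * (e * of_real x powr (e - 1))) (at x)"
    by (rule has_vector_derivative_real_field)
  then have "(g has_vector_derivative C * rGamma (e + 1) * (e * of_real x powr (e - 1))) (at x)"
    by (rule has_vector_derivative_transform_within_open[of _ _ _ "{0<..}"]) (use g Suc.prems in auto)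
  then have "vector_derivative g (at x) = C * rGamma (e + 1) * (e * of_real x powr (e - 1))"
    by (rule vector_derivative_at)
  also have "\<dots> = C * rGamma e * of_real x powr (e - 1)"
    using rGamma_plus1[of e] by (simp add: mult_ac)
  finally show ?case by (simp add: g_def e_def algebra_simps)
qed (use assms in simp)

lemma frac_op_power_fun:
  assumes b: "Re b > -1" and x: "x > 0"
  shows "frac_op a (power_fun b) x = Gamma (b + 1) * rGamma (of_real a + b + 1) * of_real x powr (of_real a + b)"
proof (cases "a \<ge> 0")
  case True
  then show ?thesis using frac_integral_power[OF _ b x] by (simp add: frac_op_def)
next
  case False
  define n where "n = nat \<lceil>-a\<rceil>"
  have n: "of_int \<lceil>-a\<rceil> + a = real n + a" "real n + a \<ge> 0" using False by (simp_all add: n_def) linarith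
  have "((\<lambda>f x. vector_derivative f (at x)) ^^ n) (frac_integral (real n + a) (power_fun b)) x
      = Gamma (b + 1) * rGamma ((of_real (real n + a) + b) + 1 - of_nat n) * of_real x powr ((of_real (real n + a) + b) - of_nat n)"
    by (rule iterated_derivative_power[OF frac_integral_power[OF n(2) b] x])
  then show ?thesis using False unfolding frac_op_def n(1) n_def[symmetric] by (simp add: algebra_simps)
qed

lemma admissible_exponents_iff: "b \<in> admissible_exponents \<longleftrightarrow> b + 1 \<notin> \<int>\<^sub>\<le>\<^sub>0"
proof -
  have "(\<exists>m::nat. m \<ge> 1 \<and> b = - of_nat m) \<longleftrightarrow> b + 1 \<in> \<int>\<^sub>\<le>\<^sub>0"
  proof
    assume "b + 1 \<in> \<int>\<^sub>\<le>\<^sub>0"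
    then obtain k where "b + 1 = - of_nat k" by (elim nonpos_Ints_cases') 
    then have "b + 1 - 1 = - of_nat k - 1" by (rule arg_cong)
    then have "b = - of_nat (Suc k)" by simp
    then show "\<exists>m::nat. m \<ge> 1 \<and> b = - of_nat m" by (intro exI[of _ "Suc k"]) simp
  next
    assume "\<exists>m::nat. m \<ge> 1 \<and> b = - of_nat m"
    then obtain m :: nat where "m \<ge> 1" "b = - of_nat m" by blast
    then have "b + 1 = - of_nat (m - 1)" by (simp add: of_nat_diff)
    then show "b + 1 \<in> \<int>\<^sub>\<le>\<^sub>0" by simp
  qed
  then show ?thesis by (simp add: admissible_exponents_def)
qed

text \<open>The closed form is itself a continuation, so the function chosen by \<open>SOME\<close>
  has the required properties. It agrees with the closed form by the identity theorem, the
  admissible set being open and, as the complement of a countable set, connected.\<close>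

lemma frac_op_power_eq:
  assumes \<beta>: "\<beta> \<in> admissible_exponents" and x: "x > 0"
  shows "frac_op_power a \<beta> x = Gamma (\<beta> + 1) * rGamma (of_real a + \<beta> + 1) * of_real x powr (of_real a + \<beta>)"
proof -
  define G where "G b = Gamma (b + 1) * rGamma (of_real a + b + 1) * of_real x powr (of_real a + b)" for b :: complex
  define Q where "Q F \<longleftrightarrow> F holomorphic_on admissible_exponents \<and>
        (\<forall>b. Re b > -1 \<longrightarrow> F b = frac_op a (power_fun b) x)" for F
  have "(\<lambda>b. Gamma (b + 1)) holomorphic_on admissible_exponents"
    by (rule holomorphic_Gamma') (auto intro!: holomorphic_intros simp: admissible_exponents_iff)
  moreover have "(\<lambda>b. of_real x powr (of_real a + b)) holomorphic_on admissible_exponents"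
    using x by (simp add: powr_def) (intro holomorphic_intros)
  ultimately have "G holomorphic_on admissible_exponents"
    unfolding G_def by (intro holomorphic_on_mult holomorphic_rGamma' holomorphic_intros)
      (auto simp: admissible_exponents_iff)
  then have QG: "Q G"
    by (simp add: Q_def G_def frac_op_power_fun[OF _ x])
  then have Q: "Q (SOME F. Q F)" by (rule someI[of Q])
  have cnt: "countable {b::complex. \<exists>m::nat. m \<ge> 1 \<and> b = - of_nat m}"
    by (rule countable_subset[of _ "range (\<lambda>m. - of_nat m)"]) auto
  have "closed ((\<lambda>z. -1 + z) ` (\<int>\<^sub>\<le>\<^sub>0 :: complex set))"
    by (intro closed_translation closed_nonpos_Ints)
  moreover have "admissible_exponents = - ((\<lambda>z. -1 + z) ` (\<int>\<^sub>\<le>\<^sub>0 :: complex set))"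
    by (force simp: admissible_exponents_iff image_iff)
  ultimately have op: "open admissible_exponents" by (metis open_Compl)
  have conn: "connected admissible_exponents"
    unfolding admissible_exponents_def
    by (intro path_connected_imp_connected path_connected_complement_countable cnt) simp
  have sub: "{b. Re b > -1} \<subseteq> admissible_exponents"
    by (auto simp: admissible_exponents_iff dest!: plus_one_nonpos_Int_Re)
  define F where "F = (SOME F. Q F)"
  have "F \<beta> = G \<beta>"
  proof (rule analytic_continuation_open[OF open_halfspace_Re_gt op _ conn sub, where f = F and g = G])
    show "F holomorphic_on admissible_exponents" "G holomorphic_on admissible_exponents"
      using Q QG by (simp_all add: Q_def F_def)
    have "(0::complex) \<in> {b. Re b > -1}" by simp
    then show "{b. Re b > -1} \<noteq> {}" by blast
  qed (use Q QG \<beta> in \<open>simp_all add: Q_def F_def\<close>)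
  then show ?thesis by (simp add: frac_op_power_def F_def Q_def G_def)
qed

section \<open>The quadrature\<close>

definition bn_fps :: "real \<Rightarrow> real \<Rightarrow> complex fps" where
  "bn_fps \<alpha> \<theta> = Abs_fps (\<lambda>j. of_real (bn_weight \<alpha> \<theta> j))"

text \<open>The denominator polynomial of the method factors as
  \<open>(3/2 - \<theta>) * (1 - X) * (1 - r * X)\<close> with this \<open>r\<close>;
  \<open>bn_scale\<close> is the power -\<alpha> of the leading constant.\<close>

definition bn_root :: "real \<Rightarrow> complex" where
  "bn_root \<theta> = of_real ((1 - 2 * \<theta>) / (3 - 2 * \<theta>))"

definition bn_scale :: "real \<Rightarrow> real \<Rightarrow> complex" where
  "bn_scale \<alpha> \<theta> = of_real ((2 / (3 - 2 * \<theta>)) powr \<alpha>)"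

text \<open>\<open>\<theta> \<le> 1\<close> is what gives \<open>r \<ge> -1\<close>. The last claim
  is the normalisation of the method at 1: the scale factor is exactly
  \<open>(1 - r) powr \<alpha>\<close>.\<close>

lemma bn_root:
  assumes "\<theta> \<le> 1"
  shows "norm (bn_root \<theta>) \<le> 1" "bn_root \<theta> \<noteq> 1" "bn_root \<theta> / (1 - bn_root \<theta>) = of_real ((1 - 2 * \<theta>) / 2)"
    "bn_scale \<alpha> \<theta> * (1 - bn_root \<theta>) powr (- of_real \<alpha>) = 1"
proof -
  define r where "r = (1 - 2 * \<theta>) / (3 - 2 * \<theta>)"
  have pos: "3 - 2 * \<theta> > 0" using assms by simp
  have r: "bn_root \<theta> = of_real r" by (simp add: bn_root_def r_def)
  have 1: "1 - r = 2 / (3 - 2 * \<theta>)" using pos by (simp add: r_def field_simps)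
  have "\<bar>r\<bar> \<le> 1" using assms pos by (simp add: r_def abs_le_iff divide_simps)
  then show "norm (bn_root \<theta>) \<le> 1" by (simp add: r)
  have "1 - r > 0" unfolding 1 using pos by simp
  then have "r \<noteq> 1" by simp
  then show "bn_root \<theta> \<noteq> 1" by (simp add: r)
  have "r / (1 - r) = (1 - 2 * \<theta>) / 2" unfolding 1 using pos by (simp add: r_def)
  moreover have "bn_root \<theta> / (1 - bn_root \<theta>) = of_real (r / (1 - r))" by (simp add: r)
  ultimately show "bn_root \<theta> / (1 - bn_root \<theta>) = of_real ((1 - 2 * \<theta>) / 2)" by (simp only:)
  have "(1 - bn_root \<theta>) powr (- of_real \<alpha>) = of_real ((1 - r) powr (-\<alpha>))"
    using powr_of_real[of "1 - r" "-\<alpha>"] \<open>1 - r > 0\<close> by (simp add: r)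
  then have "bn_scale \<alpha> \<theta> * (1 - bn_root \<theta>) powr (- of_real \<alpha>) = of_real ((1 - r) powr \<alpha> * (1 - r) powr (-\<alpha>))"
    by (simp add: bn_scale_def 1)
  also have "(1 - r) powr \<alpha> * (1 - r) powr (-\<alpha>) = 1"
    using \<open>1 - r > 0\<close> by (simp flip: powr_add)
  finally show "bn_scale \<alpha> \<theta> * (1 - bn_root \<theta>) powr (- of_real \<alpha>) = 1" by simp
qed

lemma of_real_bn_kappa:
  "of_real (bn_kappa \<alpha> \<theta> j) = fps_nth (two_pole_fps (bn_root \<theta>) (of_real \<alpha>) (of_real \<alpha>)) j"
proof -
  have "bn_kappa \<alpha> \<theta> j = (\<Sum>k\<le>j. neg_binom \<alpha> k * (((1 - 2 * \<theta>) / (3 - 2 * \<theta>)) ^ (j - k) * neg_binom \<alpha> (j - k)))"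
    unfolding bn_kappa_def sum_distrib_left
  proof (intro sum.cong refl)
    fix k assume "k \<in> {..j}"
    then have "(-1 :: real) ^ j = (-1) ^ k * (-1) ^ (j - k)" by (simp flip: power_add)
    then show "(-1) ^ j * (((1 - 2 * \<theta>) / (3 - 2 * \<theta>)) ^ (j - k) * ((-\<alpha>) gchoose k) * ((-\<alpha>) gchoose (j - k)))
        = neg_binom \<alpha> k * (((1 - 2 * \<theta>) / (3 - 2 * \<theta>)) ^ (j - k) * neg_binom \<alpha> (j - k))"
      by (simp add: neg_binom_gbinomial mult_ac)
  qed
  then show ?thesis
    by (simp add: two_pole_fps_def fps_mult_nth atLeast0AtMost neg_binom_of_real bn_root_def)
qed

text \<open>The numerator is rewritten around \<open>X = 1\<close>, as
  \<open>1 - \<alpha> * \<theta> * (1 - X)\<close>, so that its second term merely lowers the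
  exponent at 1 by one.\<close>

lemma bn_fps_eq:
  "bn_fps \<alpha> \<theta> = fps_const (bn_scale \<alpha> \<theta>) * (1 - fps_const (of_real (\<alpha> * \<theta>)) * (1 - fps_X)) *
     two_pole_fps (bn_root \<theta>) (of_real \<alpha>) (of_real \<alpha>)"
proof -
  define T where "T = two_pole_fps (bn_root \<theta>) (of_real \<alpha>) (of_real \<alpha>)"
  have "fps_nth (bn_fps \<alpha> \<theta>) j = fps_nth (fps_const (bn_scale \<alpha> \<theta>) *
      (fps_const (of_real (1 - \<alpha> * \<theta>)) * T + fps_const (of_real (\<alpha> * \<theta>)) * (fps_X * T))) j" for j
    by (cases j) (simp_all add: bn_fps_def bn_weight_def bn_scale_def of_real_bn_kappa T_def[symmetric] del: of_real_diff)
  then have "bn_fps \<alpha> \<theta> = fps_const (bn_scale \<alpha> \<theta>) *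
      (fps_const (of_real (1 - \<alpha> * \<theta>)) * T + fps_const (of_real (\<alpha> * \<theta>)) * (fps_X * T))"
    by (rule fps_ext)
  moreover have "fps_const (complex_of_real (1 - \<alpha> * \<theta>)) = 1 - fps_const (of_real (\<alpha> * \<theta>))"
    by (simp flip: fps_const_sub)
  moreover have "k * ((1 - a) * T + a * (fps_X * T)) = k * (1 - a * (1 - fps_X)) * T" for k a
    by (simp add: algebra_simps)
  ultimately show ?thesis unfolding T_def by (simp only:)
qed

lemma bn_fps_times_neg_binom:
  "bn_fps \<alpha> \<theta> * neg_binom_fps 1 \<gamma> = fps_const (bn_scale \<alpha> \<theta>) *
     (two_pole_fps (bn_root \<theta>) (of_real \<alpha> + \<gamma>) (of_real \<alpha>)
      - fps_const (of_real (\<alpha> * \<theta>)) * two_pole_fps (bn_root \<theta>) (of_real \<alpha> + \<gamma> - 1) (of_real \<alpha>))"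
proof -
  have "two_pole_fps (bn_root \<theta>) (of_real \<alpha>) (of_real \<alpha>) * neg_binom_fps 1 \<gamma>
      = two_pole_fps (bn_root \<theta>) (of_real \<alpha> + \<gamma>) (of_real \<alpha>)"
    by (simp add: two_pole_fps_def neg_binom_fps_add mult_ac)
  moreover have "(1 - fps_X) * two_pole_fps (bn_root \<theta>) (of_real \<alpha> + \<gamma>) (of_real \<alpha>)
      = two_pole_fps (bn_root \<theta>) (of_real \<alpha> + \<gamma> - 1) (of_real \<alpha>)"
    by (simp add: two_pole_fps_def neg_binom_fps_diff_one mult.assoc)
  ultimately show ?thesis
    unfolding bn_fps_eq by (metis (no_types, lifting) left_diff_distrib mult.assoc mult_1)
qed

text \<open>Near 1 the generating function is the power -\<alpha> of \<open>1 - X\<close> times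
  \<open>1 - (\<alpha> / 2) * (1 - X) + ...\<close>, so \<theta> is absent from the two leading
  terms.\<close>

lemma bn_quadrature_neg_binom:
  fixes \<alpha> \<theta> :: real and \<gamma> :: complex
  assumes \<theta>: "\<theta> \<le> 1"
  defines "\<delta> \<equiv> of_real \<alpha> + \<gamma>"
  shows "dominated_by (\<lambda>n. fps_nth (bn_fps \<alpha> \<theta> * neg_binom_fps 1 \<gamma>) n
            - (neg_binom \<delta> n - of_real (\<alpha> / 2) * neg_binom (\<delta> - 1) n))
          (\<lambda>n. weight (\<alpha> + Re \<gamma> - 3) n + weight (\<alpha> - 1) n)"
proof -
  define r where "r = bn_root \<theta>"
  define K where "K = bn_scale \<alpha> \<theta>"
  define b where "b = (1 - r) powr (- of_real \<alpha>)"
  define c where "c = of_real \<alpha> * r / (1 - r)"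
  define d where "d = complex_of_real (\<alpha> * \<theta>)"
  note r = bn_root(1,2)[OF \<theta>, folded r_def]
  define E where "E \<delta> n = fps_nth (two_pole_fps r \<delta> (of_real \<alpha>)) n - b * (neg_binom \<delta> n - c * neg_binom (\<delta> - 1) n)" for \<delta> n
  have E: "dominated_by (E \<delta>) (\<lambda>n. weight (Re \<delta> - 3) n + weight (\<alpha> - 1) n)" for \<delta>
    using two_pole_expansion[OF r, of \<delta> "of_real \<alpha>"] by (simp add: E_def[abs_def] b_def c_def)
  have "c + d = of_real \<alpha> * (r / (1 - r)) + d" by (simp add: c_def)
  also have "\<dots> = of_real (\<alpha> * ((1 - 2 * \<theta>) / 2) + \<alpha> * \<theta>)"
    unfolding r_def bn_root(3)[OF \<theta>] d_def by simp
  also have "\<alpha> * ((1 - 2 * \<theta>) / 2) + \<alpha> * \<theta> = \<alpha> / 2" by (simp add: field_simps)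
  finally have cd: "of_real (\<alpha> / 2) = c + d" ..
  have Kb: "K * b = 1" using bn_root(4)[OF \<theta>] by (simp add: K_def b_def r_def)
  \<comment> \<open>\<open>d * c\<close> is the product of the two first-order corrections, from the
    numerator and from the second linear factor; it is of second order and joins the error.\<close>
  have eq: "fps_nth (bn_fps \<alpha> \<theta> * neg_binom_fps 1 \<gamma>) n
            - (neg_binom \<delta> n - of_real (\<alpha> / 2) * neg_binom (\<delta> - 1) n)
      = K * E \<delta> n - (K * d) * E (\<delta> - 1) n + (d * c) * neg_binom (\<delta> - 2) n" for n
  proof -
    have "fps_nth (bn_fps \<alpha> \<theta> * neg_binom_fps 1 \<gamma>) n
        = K * (fps_nth (two_pole_fps r \<delta> (of_real \<alpha>)) n - d * fps_nth (two_pole_fps r (\<delta> - 1) (of_real \<alpha>)) n)"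
      unfolding bn_fps_times_neg_binom K_def d_def r_def \<delta>_def by simp
    also have "\<dots> = K * E \<delta> n - (K * d) * E (\<delta> - 1) n + (K * b) * ((neg_binom \<delta> n - c * neg_binom (\<delta> - 1) n)
        - d * (neg_binom (\<delta> - 1) n - c * neg_binom (\<delta> - 2) n))"
      unfolding E_def by (simp add: algebra_simps)
    finally show ?thesis unfolding Kb cd by (simp add: algebra_simps)
  qed
  have Re: "Re \<delta> = \<alpha> + Re \<gamma>" by (simp add: \<delta>_def)
  have 1: "dominated_by (E \<delta>) (\<lambda>n. weight (\<alpha> + Re \<gamma> - 3) n + weight (\<alpha> - 1) n)"
    using E[of \<delta>] by (simp add: Re)
  have 2: "dominated_by (E (\<delta> - 1)) (\<lambda>n. weight (\<alpha> + Re \<gamma> - 3) n + weight (\<alpha> - 1) n)"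
    by (rule dominated_by_weight2_mono[OF E]) (simp_all add: Re)
  have 3: "dominated_by (neg_binom (\<delta> - 2)) (\<lambda>n. weight (\<alpha> + Re \<gamma> - 3) n + weight (\<alpha> - 1) n)"
    by (rule dominated_by_weight2I1[OF dominated_by_neg_binom]) (simp add: Re)
  show ?thesis
    unfolding eq by (intro dominated_by_add dominated_by_diff dominated_by_cmult 1 2 3)
qed

lemma bn_quadrature_neg_binom_first_order:
  assumes "\<theta> \<le> 1"
  shows "dominated_by (\<lambda>n. fps_nth (bn_fps \<alpha> \<theta> * neg_binom_fps 1 \<gamma>) n - neg_binom (of_real \<alpha> + \<gamma>) n)
          (\<lambda>n. weight (\<alpha> + Re \<gamma> - 2) n + weight (\<alpha> - 1) n)"
proof -
  have 1: "dominated_by (\<lambda>n. fps_nth (bn_fps \<alpha> \<theta> * neg_binom_fps 1 \<gamma>) n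
            - (neg_binom (of_real \<alpha> + \<gamma>) n - of_real (\<alpha> / 2) * neg_binom (of_real \<alpha> + \<gamma> - 1) n))
          (\<lambda>n. weight (\<alpha> + Re \<gamma> - 2) n + weight (\<alpha> - 1) n)"
    by (rule dominated_by_weight2_mono[OF bn_quadrature_neg_binom[OF assms]]) simp_all
  have 2: "dominated_by (neg_binom (of_real \<alpha> + \<gamma> - 1)) (\<lambda>n. weight (\<alpha> + Re \<gamma> - 2) n + weight (\<alpha> - 1) n)"
    by (rule dominated_by_weight2I1[OF dominated_by_neg_binom]) simp
  show ?thesis
    by (rule dominated_by_cong[OF dominated_by_diff[OF 1 dominated_by_cmult[OF 2, of "of_real (\<alpha> / 2)"]]]) simp
qed

lemma bn_quadrature_neg_binom_bound:
  assumes "\<theta> \<le> 1"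
  shows "dominated_by (fps_nth (bn_fps \<alpha> \<theta> * neg_binom_fps 1 \<gamma>))
          (\<lambda>n. weight (\<alpha> + Re \<gamma> - 1) n + weight (\<alpha> - 1) n)"
proof -
  have 1: "dominated_by (\<lambda>n. fps_nth (bn_fps \<alpha> \<theta> * neg_binom_fps 1 \<gamma>) n - neg_binom (of_real \<alpha> + \<gamma>) n)
          (\<lambda>n. weight (\<alpha> + Re \<gamma> - 1) n + weight (\<alpha> - 1) n)"
    by (rule dominated_by_weight2_mono[OF bn_quadrature_neg_binom_first_order[OF assms]]) simp_all
  have 2: "dominated_by (neg_binom (of_real \<alpha> + \<gamma>)) (\<lambda>n. weight (\<alpha> + Re \<gamma> - 1) n + weight (\<alpha> - 1) n)"
    by (rule dominated_by_weight2I1[OF dominated_by_neg_binom]) simp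
  show ?thesis
    by (rule dominated_by_cong[OF dominated_by_add[OF 1 2]]) simp
qed

text \<open>The case \<gamma> = 0, in which the quadrature returns the weights themselves.\<close>

lemma dominated_by_bn_fps:
  assumes "\<theta> \<le> 1"
  shows "dominated_by (fps_nth (bn_fps \<alpha> \<theta>)) (weight (\<alpha> - 1))"
proof -
  have "neg_binom_fps 1 0 = (1 :: complex fps)"
    by (rule fps_ext) (simp add: neg_binom_def pochhammer_0_left)
  then show ?thesis
    using dominated_by_mono[OF bn_quadrature_neg_binom_bound[OF assms, of \<alpha> 0], of 2 "weight (\<alpha> - 1)"] by simp
qed

text \<open>The expansion of \<open>n powr (\<delta> - 1)\<close> multiplied by
  \<open>rGamma \<delta>\<close>, which makes it valid for all \<delta>: at nonpositive integers
  \<open>rGamma \<delta>\<close> is 0 and both coefficients vanish for large \<open>n\<close>. This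
  covers exponents \<open>\<alpha> + \<beta>\<close> that are negative integers.\<close>

lemma rGamma_powr_expansion:
  "dominated_by (\<lambda>n. rGamma \<delta> * of_nat n powr (\<delta> - 1) - (neg_binom \<delta> n - \<delta> / 2 * neg_binom (\<delta> - 1) n))
     (weight (Re \<delta> - 3))"
proof (cases "\<delta> \<in> \<int>\<^sub>\<le>\<^sub>0")
  case True
  then obtain m where m: "\<delta> = - of_nat m" by (elim nonpos_Ints_cases')
  have "norm (rGamma \<delta> * of_nat n powr (\<delta> - 1) - (neg_binom \<delta> n - \<delta> / 2 * neg_binom (\<delta> - 1) n)) \<le> 0 * weight (Re \<delta> - 3) n"
    if "n \<ge> Suc (Suc m)" for n
  proof -
    have "neg_binom \<delta> n = 0" unfolding m by (rule neg_binom_nonpos_int) (use that in simp)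
    moreover have "\<delta> - 1 = - of_nat (Suc m)" by (simp add: m)
    then have "neg_binom (\<delta> - 1) n = 0" using that by (simp only: neg_binom_nonpos_int)
    moreover have "rGamma \<delta> = 0" using True by (simp add: rGamma_eq_zero_iff)
    ultimately show ?thesis by simp
  qed
  then show ?thesis
    by (intro dominated_by_eventuallyI[where C = 0]) (auto simp: eventually_sequentially)
next
  case False
  then obtain a where a: "a 0 = Gamma \<delta>" "a 1 = - Gamma \<delta> * \<delta> / 2"
    "dominated_by (\<lambda>n. of_nat n powr (\<delta> - 1) - (\<Sum>k<3. a k * neg_binom (\<delta> - of_nat k) n)) (weight (Re (\<delta> - 1) - real 3))"
    using powr_neg_binom_expansion[of "\<delta> - 1" 3] by auto
  have "Gamma \<delta> \<noteq> 0" using False by (simp add: Gamma_eq_zero_iff)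
  then have G: "rGamma \<delta> * Gamma \<delta> = 1" by (simp add: rGamma_inverse_Gamma)
  have 1: "dominated_by (\<lambda>n. of_nat n powr (\<delta> - 1) - (\<Sum>k<3. a k * neg_binom (\<delta> - of_nat k) n)) (weight (Re \<delta> - 3))"
    by (rule dominated_by_weight_mono[OF a(3)]) simp
  have 2: "dominated_by (neg_binom (\<delta> - 2)) (weight (Re \<delta> - 3))"
    by (rule dominated_by_weight_mono[OF dominated_by_neg_binom]) simp
  show ?thesis
  proof (rule dominated_by_cong[OF dominated_by_add[OF dominated_by_cmult[OF 1, of "rGamma \<delta>"]
          dominated_by_cmult[OF 2, of "rGamma \<delta> * a 2"]]])
    fix n
    have "(\<Sum>k<3. a k * neg_binom (\<delta> - of_nat k) n)
        = Gamma \<delta> * (neg_binom \<delta> n - \<delta> / 2 * neg_binom (\<delta> - 1) n) + a 2 * neg_binom (\<delta> - 2) n"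
      using a(1,2) by (simp add: numeral_3_eq_3 numeral_2_eq_2 algebra_simps)
    then have "rGamma \<delta> * (of_nat n powr (\<delta> - 1) - (\<Sum>k<3. a k * neg_binom (\<delta> - of_nat k) n)) + rGamma \<delta> * a 2 * neg_binom (\<delta> - 2) n
        = rGamma \<delta> * of_nat n powr (\<delta> - 1) - (rGamma \<delta> * Gamma \<delta>) * (neg_binom \<delta> n - \<delta> / 2 * neg_binom (\<delta> - 1) n)"
      by (simp only: right_diff_distrib distrib_left mult.assoc) simp
    then show "rGamma \<delta> * of_nat n powr (\<delta> - 1) - (neg_binom \<delta> n - \<delta> / 2 * neg_binom (\<delta> - 1) n)
      = rGamma \<delta> * (of_nat n powr (\<delta> - 1) - (\<Sum>k<3. a k * neg_binom (\<delta> - of_nat k) n)) + rGamma \<delta> * a 2 * neg_binom (\<delta> - 2) n"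
      unfolding G by simp
  qed
qed

lemma bn_quadrature_error:
  assumes \<theta>: "\<theta> \<le> 1" and \<beta>: "\<beta> + 1 \<notin> \<int>\<^sub>\<le>\<^sub>0"
  shows "dominated_by (\<lambda>n. Gamma (\<beta> + 1) * rGamma (of_real \<alpha> + \<beta> + 1) * of_nat n powr (of_real \<alpha> + \<beta>)
            - (\<Sum>j\<le>n. of_real (bn_weight \<alpha> \<theta> (n - j)) * power_fun \<beta> (real j)))
          (\<lambda>n. weight (\<alpha> + Re \<beta> - 2) n + weight (\<alpha> - 1) n)"
proof -
  define \<delta> where "\<delta> = of_real \<alpha> + \<beta> + 1"
  define g where "g j = power_fun \<beta> (real j)" for j
  define w where "w n = weight (\<alpha> + Re \<beta> - 2) n + weight (\<alpha> - 1) n" for n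
  \<comment> \<open>Enough terms for the remainder to be absolutely summable and no larger than
    \<open>n powr (\<alpha> - 1)\<close>, so that its convolution with the weights keeps that
    size.\<close>
  define N where "N = nat \<lceil>\<bar>Re \<beta>\<bar> + \<bar>\<alpha>\<bar>\<rceil> + 3"
  define M where "M = N - 2"
  have N: "N \<ge> 3" "Re \<beta> - real N \<le> -2" "Re \<beta> - real N \<le> \<alpha> - 1" unfolding N_def by linarith+
  have NM: "N = Suc (Suc M)" using N(1) by (simp add: M_def)
  obtain a where a: "a 0 = Gamma (\<beta> + 1)" "a 1 = - Gamma (\<beta> + 1) * (\<beta> + 1) / 2"
    "dominated_by (\<lambda>n. of_nat n powr \<beta> - (\<Sum>k<N. a k * neg_binom (\<beta> + 1 - of_nat k) n)) (weight (Re \<beta> - real N))"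
    using powr_neg_binom_expansion[OF \<beta> N(1)] by blast
  define R where "R n = g n - (\<Sum>k<N. a k * neg_binom (\<beta> + 1 - of_nat k) n)" for n
  define Q where "Q k n = fps_nth (bn_fps \<alpha> \<theta> * neg_binom_fps 1 (\<beta> + 1 - of_nat k)) n" for k n
  define V where "V n = fps_nth (bn_fps \<alpha> \<theta> * Abs_fps R) n" for n
  \<comment> \<open>\<open>power_fun \<beta>\<close> and \<open>powr\<close> differ only at index 0,
    and only for \<beta> = 0; the change is absorbed by the constant.\<close>
  have R: "dominated_by R (weight (Re \<beta> - real N))"
    by (rule dominated_by_cong_positive[OF a(3) weight_pos]) (simp add: R_def g_def power_fun_def)
  have V: "dominated_by V w"
  proof -
    have "dominated_by (\<lambda>n. \<Sum>k\<le>n. fps_nth (bn_fps \<alpha> \<theta>) k * R (n - k))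
        (\<lambda>n. weight (\<alpha> - 1) n + weight ((Re \<beta> - real N + 1) - 1) n)"
      by (rule dominated_by_convolution[OF dominated_by_bn_fps[OF \<theta>]]) (use R N in simp_all)
    then have "dominated_by V (\<lambda>n. weight (\<alpha> - 1) n + weight (Re \<beta> - real N) n)"
      by (simp add: V_def[abs_def] fps_mult_nth atLeast0AtMost)
    then have "dominated_by V (weight (\<alpha> - 1))"
      by (rule dominated_by_mono[where K = 2]) (use weight_mono[OF N(3)] in \<open>auto intro: add_nonneg_nonneg\<close>)
    then show ?thesis unfolding w_def by (rule dominated_by_weight2I2) simp
  qed
  have expand: "(\<Sum>j\<le>n. of_real (bn_weight \<alpha> \<theta> (n - j)) * g j) = (\<Sum>k<N. a k * Q k n) + V n" for n
  proof -
    have "Abs_fps g = (\<Sum>k<N. fps_const (a k) * neg_binom_fps 1 (\<beta> + 1 - of_nat k)) + Abs_fps R"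
      by (rule fps_ext) (simp add: R_def fps_sum_nth)
    then have "bn_fps \<alpha> \<theta> * Abs_fps g = (\<Sum>k<N. fps_const (a k) * (bn_fps \<alpha> \<theta> * neg_binom_fps 1 (\<beta> + 1 - of_nat k))) + bn_fps \<alpha> \<theta> * Abs_fps R"
      by (simp add: distrib_left sum_distrib_left mult.left_commute)
    then have "fps_nth (Abs_fps g * bn_fps \<alpha> \<theta>) n = (\<Sum>k<N. a k * Q k n) + V n"
      by (simp add: Q_def V_def fps_sum_nth mult.commute[of "Abs_fps g"])
    then show ?thesis
      by (simp add: fps_mult_nth atLeast0AtMost bn_fps_def mult.commute)
  qed
  \<comment> \<open>\<open>A\<close> is the second-order error of the exact value and
    \<open>B\<close> that of the leading basis element. For the next basis element a first-order
    error \<open>D\<close> is enough, and later ones are within the bound already.\<close>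
  define A where "A n = rGamma \<delta> * of_nat n powr (\<delta> - 1) - (neg_binom \<delta> n - \<delta> / 2 * neg_binom (\<delta> - 1) n)" for n
  define B where "B n = Q 0 n - (neg_binom \<delta> n - of_real (\<alpha> / 2) * neg_binom (\<delta> - 1) n)" for n
  define D where "D n = Q 1 n - neg_binom (\<delta> - 1) n" for n
  have A: "dominated_by A w"
    unfolding w_def A_def by (rule dominated_by_weight2I1[OF rGamma_powr_expansion]) (simp add: \<delta>_def)
  have B: "dominated_by B w"
    unfolding w_def
    by (rule dominated_by_weight2_mono[OF bn_quadrature_neg_binom[OF \<theta>, of \<alpha> "\<beta> + 1", folded add.assoc, folded \<delta>_def],
          unfolded B_def[abs_def] Q_def, THEN dominated_by_cong]) (simp_all add: B_def Q_def)
  have D: "dominated_by D w"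
    using bn_quadrature_neg_binom_first_order[OF \<theta>, of \<alpha> \<beta>] by (simp add: D_def[abs_def] Q_def \<delta>_def w_def[abs_def])
  have Qk: "dominated_by (Q (Suc (Suc k))) w" for k
    unfolding w_def Q_def by (rule dominated_by_weight2_mono[OF bn_quadrature_neg_binom_bound[OF \<theta>]]) simp_all
  have w_nonneg: "w n \<ge> 0" for n by (simp add: w_def)
  have "dominated_by (\<lambda>n. Gamma (\<beta> + 1) * A n - a 0 * B n - a 1 * D n - (\<Sum>k<M. a (Suc (Suc k)) * Q (Suc (Suc k)) n) - V n) w"
    by (intro dominated_by_diff dominated_by_cmult dominated_by_sum A B D Qk V w_nonneg)
  moreover have "Gamma (\<beta> + 1) * A n - a 0 * B n - a 1 * D n - (\<Sum>k<M. a (Suc (Suc k)) * Q (Suc (Suc k)) n) - V n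
      = Gamma (\<beta> + 1) * rGamma \<delta> * of_nat n powr (\<delta> - 1) - (\<Sum>j\<le>n. of_real (bn_weight \<alpha> \<theta> (n - j)) * g j)" for n
  proof -
    have Qsum: "(\<Sum>k<N. a k * Q k n) = a 0 * Q 0 n + a 1 * Q 1 n + (\<Sum>k<M. a (Suc (Suc k)) * Q (Suc (Suc k)) n)"
      unfolding NM sum.lessThan_Suc_shift by simp
    \<comment> \<open>The terms in \<open>neg_binom (\<delta> - 1)\<close> cancel: the correction
      \<delta>/2 of the exact value splits into \<alpha>/2 from the weights and (\<beta> + 1)/2 from
      expanding \<open>n powr \<beta>\<close>.\<close>
    have "\<delta> / 2 = of_real (\<alpha> / 2) + (\<beta> + 1) / 2"
      by (simp add: \<delta>_def field_simps)
    moreover have "x * (y + z / 2) = x * y - - x * z / 2" for x y z :: complex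
      by (simp add: algebra_simps)
    ultimately have "Gamma (\<beta> + 1) * (\<delta> / 2) = a 0 * of_real (\<alpha> / 2) - a 1"
      using a(1,2) by (simp only:)
    then have "Gamma (\<beta> + 1) * (\<delta> / 2) * neg_binom (\<delta> - 1) n = (a 0 * of_real (\<alpha> / 2) - a 1) * neg_binom (\<delta> - 1) n"
      by (rule arg_cong)
    then show ?thesis
      unfolding expand Qsum A_def B_def D_def using a(1) by (simp add: algebra_simps)
  qed
  ultimately show ?thesis
    unfolding w_def[abs_def] g_def \<delta>_def by (simp add: add.assoc)
qed

section \<open>Scaling to the step size h\<close>

lemma weight_le_powr: "n \<ge> 1 \<Longrightarrow> weight s n \<le> 2 powr \<bar>s\<bar> * real n powr s"
proof (cases "s \<ge> 0")
  case True
  assume "n \<ge> 1"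
  then have "weight s n \<le> (2 * real n) powr s"
    unfolding weight_def using True by (intro powr_mono2) auto
  then show ?thesis using True by (simp add: powr_mult)
next
  case False
  assume n: "n \<ge> 1"
  then have "weight s n \<le> 1 * real n powr s"
    unfolding weight_def using False by (simp add: powr_mono2')
  also have "\<dots> \<le> 2 powr \<bar>s\<bar> * real n powr s"
    by (intro mult_right_mono ge_one_powr_ge_zero) auto
  finally show ?thesis .
qed

lemma power_fun_scale:
  assumes "h > 0"
  shows "power_fun \<beta> (real j * h) = of_real h powr \<beta> * power_fun \<beta> (real j)"
  using assms powr_times_real[of "of_real (real j)" "of_real h" \<beta>] by (simp add: power_fun_def mult_ac)

theorem theorem3p5:
  fixes \<alpha> \<theta> L :: real
  assumes "\<theta> \<le> 1"
  shows "conv_quad_convergent_order2 L \<alpha> (bn_weight \<alpha> \<theta>)"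
  unfolding conv_quad_convergent_order2_def
proof
  fix \<beta> assume adm: "\<beta> \<in> admissible_exponents"
  then have \<beta>: "\<beta> + 1 \<notin> \<int>\<^sub>\<le>\<^sub>0" by (simp add: admissible_exponents_iff)
  define s where "s = \<alpha> + Re \<beta> - 2"
  define t where "t = \<alpha> - 1"
  define err where "err n = Gamma (\<beta> + 1) * rGamma (of_real \<alpha> + \<beta> + 1) * of_nat n powr (of_real \<alpha> + \<beta>)
            - (\<Sum>j\<le>n. of_real (bn_weight \<alpha> \<theta> (n - j)) * power_fun \<beta> (real j))" for n
  have "dominated_by err (\<lambda>n. weight s n + weight t n)"
    unfolding err_def s_def t_def by (rule bn_quadrature_error[OF assms \<beta>])
  then obtain C where C: "C > 0" "\<And>n. norm (err n) \<le> C * (weight s n + weight t n)"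
    by (rule dominated_byE) auto
  \<comment> \<open>The cost of replacing \<open>n + 1\<close> by \<open>n\<close> in both
    weights.\<close>
  define P where "P = max (2 powr \<bar>s\<bar>) (2 powr \<bar>t\<bar>)"
  show "\<exists>C::real. \<forall>n::nat. \<forall>h::real. n \<ge> 1 \<and> h > 0 \<and> real n * h \<le> L \<longrightarrow>
        norm (frac_op_power \<alpha> \<beta> (real n * h)
              - of_real (h powr \<alpha>) *
                  (\<Sum>j\<le>n. of_real (bn_weight \<alpha> \<theta> (n - j)) * power_fun \<beta> (real j * h)))
        \<le> C * ((real n * h) powr (\<alpha> + Re \<beta> - 2) * h ^ 2
               + (real n * h) powr (\<alpha> - 1) * h powr (Re \<beta> + 1))"
  proof (intro exI[of _ "C * P"] allI impI)
    fix n :: nat and h :: real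
    assume *: "n \<ge> 1 \<and> h > 0 \<and> real n * h \<le> L"
    then have n: "n \<ge> 1" and h: "h > 0" by auto
    define q where "q = of_real h powr (of_real \<alpha> + \<beta>)"
    have q: "of_real (h powr \<alpha>) * of_real h powr \<beta> = q"
      using h by (simp add: q_def powr_add powr_of_real)
    have "frac_op_power \<alpha> \<beta> (real n * h) = Gamma (\<beta> + 1) * rGamma (of_real \<alpha> + \<beta> + 1) * of_real (real n * h) powr (of_real \<alpha> + \<beta>)"
      using n h by (intro frac_op_power_eq adm) auto
    also have "of_real (real n * h) powr (of_real \<alpha> + \<beta>) = of_nat n powr (of_real \<alpha> + \<beta>) * q"
      using powr_times_real[of "of_real (real n)" "of_real h" "of_real \<alpha> + \<beta>"] h by (simp add: q_def)
    finally have I: "frac_op_power \<alpha> \<beta> (real n * h)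
        = q * (Gamma (\<beta> + 1) * rGamma (of_real \<alpha> + \<beta> + 1) * of_nat n powr (of_real \<alpha> + \<beta>))" by simp
    have "of_real (h powr \<alpha>) * (\<Sum>j\<le>n. of_real (bn_weight \<alpha> \<theta> (n - j)) * power_fun \<beta> (real j * h))
        = q * (\<Sum>j\<le>n. of_real (bn_weight \<alpha> \<theta> (n - j)) * power_fun \<beta> (real j))"
      unfolding power_fun_scale[OF h] q[symmetric] by (simp add: sum_distrib_left mult_ac)
    then have "frac_op_power \<alpha> \<beta> (real n * h)
              - of_real (h powr \<alpha>) * (\<Sum>j\<le>n. of_real (bn_weight \<alpha> \<theta> (n - j)) * power_fun \<beta> (real j * h))
        = q * err n"
      unfolding I err_def by (simp only: right_diff_distrib)
    moreover have nq: "norm q = h powr (\<alpha> + Re \<beta>)" using h by (simp add: q_def norm_powr_real_powr)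
    moreover have "norm (err n) \<le> C * P * (real n powr s + real n powr t)"
    proof -
      have "weight s n \<le> P * real n powr s" "weight t n \<le> P * real n powr t"
        using weight_le_powr[OF n, of s] weight_le_powr[OF n, of t]
          mult_right_mono[of "2 powr \<bar>s\<bar>" P "real n powr s"] mult_right_mono[of "2 powr \<bar>t\<bar>" P "real n powr t"]
        by (auto simp: P_def intro: order_trans)
      then have "C * (weight s n + weight t n) \<le> C * (P * real n powr s + P * real n powr t)"
        using C(1) by (intro mult_left_mono add_mono) auto
      then show ?thesis using C(2)[of n] by (simp add: algebra_simps)
    qed
    ultimately have "norm (frac_op_power \<alpha> \<beta> (real n * h)
              - of_real (h powr \<alpha>) * (\<Sum>j\<le>n. of_real (bn_weight \<alpha> \<theta> (n - j)) * power_fun \<beta> (real j * h)))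
        \<le> h powr (\<alpha> + Re \<beta>) * (C * P * (real n powr s + real n powr t))"
      by (simp add: norm_mult mult_left_mono)
    also have "\<dots> = C * P * (real n powr s * h powr (\<alpha> + Re \<beta>) + real n powr t * h powr (\<alpha> + Re \<beta>))"
      by (simp add: algebra_simps)
    \<comment> \<open>The power of \<open>h\<close> is split as
      \<open>\<alpha> + Re \<beta> = s + 2\<close> here and as \<open>t + (Re \<beta> + 1)\<close>
      for the other term, so that \<open>n powr s\<close> and \<open>n powr t\<close> become powers
      of the grid point.\<close>
    also have "real n powr s * h powr (\<alpha> + Re \<beta>) = (real n * h) powr (\<alpha> + Re \<beta> - 2) * h ^ 2"
    proof -
      have "h powr (\<alpha> + Re \<beta>) = h powr s * h powr 2" by (simp add: s_def flip: powr_add)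
      also have "h powr 2 = h ^ 2" using h by (simp add: powr_numeral)
      finally show ?thesis by (simp add: powr_mult s_def)
    qed
    also have "real n powr t * h powr (\<alpha> + Re \<beta>) = (real n * h) powr (\<alpha> - 1) * h powr (Re \<beta> + 1)"
      by (simp add: powr_mult t_def flip: powr_add)
    finally show "norm (frac_op_power \<alpha> \<beta> (real n * h)
              - of_real (h powr \<alpha>) *
                  (\<Sum>j\<le>n. of_real (bn_weight \<alpha> \<theta> (n - j)) * power_fun \<beta> (real j * h)))
        \<le> C * P * ((real n * h) powr (\<alpha> + Re \<beta> - 2) * h ^ 2
               + (real n * h) powr (\<alpha> - 1) * h powr (Re \<beta> + 1))" .
  qed
qed

end
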